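(* Let $X$ be an infinite Tychonoff space. The following are equivalent: (1) $\mathcal P_{\mathrm{fin}}(X)$ is Hurewicz. (2) $\mathcal P_{\mathrm{fin}}(X)\models\mathsf S_{\mathrm{fin}}(\Omega,\Omega^{\mathrm{gp}})$. (3) $X\models\mathsf S_{\mathrm{fin}}(\Omega,\Omega^{\mathrm{gp}})$. (4) Every finite power of $X$ is Hurewicz. (5) One does not have a winning strategy in $\mathsf G_{\mathrm{fin}}(\Omega_X,\Omega_X^{\mathrm{gp}})$. (6) $C_p(X)\models\mathsf S_{\mathrm{fin}}(\Omega_{C_p(X),\mathbf 0},\Omega_{C_p(X),\mathbf 0}^{\mathrm{gp}})$. (7) $C_p(X)$ is Reznichenko and has countable fan-tightness.
   Context: Tychonoff spaces are Hausdorff. For a set $Y$, $[Y]^{<\omega}$ is the set of non-empty finite subsets of $Y$ and $[Y]^\omega$ is the set of countably infinite subsets of $Y$. For a space $Z$, $\mathscr T_Z$ is the set of open $U\subseteq Z$ with $U\neq\emptyset$ and $U\neq Z$; $\mathcal O_Z$ is the set of all $\mathscr U\subseteq\mathscr T_Z$ with $\bigcup\mathscr U=Z$; $\Omega_Z$ (the $\omega$-covers) is the set of all $\mathscr U\in\mathcal O_Z$ such that every $F\in[Z]^{<\omega}$ is contained in some $U\in\mathscr U$. $\mathcal P_{\mathrm{fin}}(X)$ is the set $[X]^{<\omega}$ with the subspace topology inherited from the space of non-empty compact subsets of $X$ with the Vietoris topology (generated by the sets $\{K:K\subseteq U\}$ and $\{K:K\cap U\neq\emptyset\}$ for $U\subseteq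 X$ open). $Z$ is Hurewicz if for every sequence $\langle\mathscr U_n:n\in\omega\rangle$ in $\mathcal O_Z$ there are $\mathscr F_n\in[\mathscr U_n]^{<\omega}$ such that for every $z\in Z$ there is $m$ with $z\in\bigcup\mathscr F_n$ for all $n\geq m$. $C_p(X)$ is the set of continuous real-valued functions on $X$ with the topology of pointwise convergence; $\mathbf 0$ is the constant zero function. For a class $\mathfrak C$, $\mathscr C\in\mathfrak C$ is groupable if there is $\phi:\mathscr C\to\omega$ with every $\phi^{-1}(n)$ finite and with $\bigcup\{\phi^{-1}(n):n\in J\}\in\mathfrak C$ for every infinite $J\subseteq\omega$; $\mathfrak C^{\mathrm{gp}}$ is the set of groupable members of $\mathfrak C$. $\mathsf S_{\mathrm{fin}}(\mathcal A,\mathcal B)$: for every sequence $\langle\mathscr U_n:n\in\omega\rangle$ in $\mathcal A$ there are $\mathscr F_n\in[\mathscr U_n]^{<\omega}$ with $\bigcup_n\mathscr F_n\in\mathcal B$. $Z\models\mathsf S_{\mathrm{fin}}(\Omega,\Omega^{\mathrm{gp}})$ means $\mathsf S_{\mathrm{fin}}(\Omega_Z,\Omega_Z^{\mathrm{gp}})$ holds; $Z\models\mathsf S_{\mathrm{fin}}(\mathcal A,\mathcal B)$ for specific collections means the principle holds for these collections. In the game $\mathsf G_{\mathrm{fin}}(\mathcal A,\mathcal B)$, in inning $n\in\omega$ One plays $A_n\in\mathcal A$ and Two responds with $\mathscr F_n\in[A_n]^{<\omega}$; Two wins if $\bigcup_n\mathscr F_n\in\mathcal B$, otherwise One wins. A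 strategy for One is a function $\sigma$ from finite sequences of Two's moves to $\mathcal A$; it is winning if for every sequence with $\mathscr F_n\in[\sigma(\langle\mathscr F_k:k<n\rangle)]^{<\omega}$ for all $n$, $\bigcup_n\mathscr F_n\notin\mathcal B$. For a space $Z$ and $z\in Z$, $\Omega_{Z,z}=\{A\subseteq Z: z\in\mathrm{cl}(A)\setminus A\}$. $Z$ has countable fan-tightness if $\mathsf S_{\mathrm{fin}}(\Omega_{Z,z},\Omega_{Z,z})$ holds for every $z\in Z$. $Z$ is Reznichenko if $\Omega_{Z,z}\cap[Z]^\omega=\Omega_{Z,z}^{\mathrm{gp}}$ for every $z\in Z$. *)

theory Defs
  imports "HOL-Analysis.Analysis"
begin

definition fin_subsets :: "'a set \<Rightarrow> 'a set set" where
  "fin_subsets Y = {F. F \<subseteq> Y \<and> finite F \<and> F \<noteq> {}}"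

definition ctbl_subsets :: "'a set \<Rightarrow> 'a set set" where
  "ctbl_subsets Y = {A. A \<subseteq> Y \<and> countable A \<and> infinite A}"


definition proper_opens :: "'a topology \<Rightarrow> 'a set set" where
  "proper_opens Z = {U. openin Z U \<and> U \<noteq> {} \<and> U \<noteq> topspace Z}"

definition open_covers :: "'a topology \<Rightarrow> 'a set set set" where
  "open_covers Z = {\<U>. \<U> \<subseteq> proper_opens Z \<and> \<Union>\<U> = topspace Z}"

definition omega_covers :: "'a topology \<Rightarrow> 'a set set set" where
  "omega_covers Z = {\<U> \<in> open_covers Z. \<forall>F \<in> fin_subsets (topspace Z). \<exists>U\<in>\<U>. F \<subseteq> U}"

definition Hurewicz_space :: "'a topology \<Rightarrow> bool" where
  "Hurewicz_space Z \<longleftrightarrow>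
     (\<forall>\<U> :: nat \<Rightarrow> 'a set set. (\<forall>n. \<U> n \<in> open_covers Z) \<longrightarrow>
        (\<exists>\<F>. (\<forall>n. \<F> n \<in> fin_subsets (\<U> n)) \<and>
             (\<forall>z\<in>topspace Z. \<exists>m. \<forall>n\<ge>m. z \<in> \<Union>(\<F> n))))"


definition groupable_in :: "'b set set \<Rightarrow> 'b set \<Rightarrow> bool" where
  "groupable_in \<CC> C \<longleftrightarrow>
     (\<exists>\<phi> :: 'b \<Rightarrow> nat. (\<forall>n. finite {c\<in>C. \<phi> c = n}) \<and>
        (\<forall>J. infinite J \<longrightarrow> (\<Union>n\<in>J. {c\<in>C. \<phi> c = n}) \<in> \<CC>))"

definition gp :: "'b set set \<Rightarrow> 'b set set" where
  "gp \<CC> = {C \<in> \<CC>. groupable_in \<CC> C}"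

definition S_fin :: "'b set set \<Rightarrow> 'b set set \<Rightarrow> bool" where
  "S_fin \<A> \<B> \<longleftrightarrow>
     (\<forall>A :: nat \<Rightarrow> 'b set. (\<forall>n. A n \<in> \<A>) \<longrightarrow>
        (\<exists>F. (\<forall>n. F n \<in> fin_subsets (A n)) \<and> (\<Union>n. F n) \<in> \<B>))"

text \<open>A strategy for One is defined on all finite sequences of potential moves of Two, that is,
  of non-empty finite subsets of members of \<open>\<A>\<close>; only its values on lists of moves that are
  legal against it matter for whether it is winning.\<close>

definition G_fin_strategy_One :: "'b set set \<Rightarrow> ('b set list \<Rightarrow> 'b set) \<Rightarrow> bool" where
  "G_fin_strategy_One \<A> \<sigma> \<longleftrightarrow> (\<forall>s \<in> lists (\<Union>A\<in>\<A>. fin_subsets A). \<sigma> s \<in> \<A>)"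

definition G_fin_winning_One ::
    "'b set set \<Rightarrow> 'b set set \<Rightarrow> ('b set list \<Rightarrow> 'b set) \<Rightarrow> bool" where
  "G_fin_winning_One \<A> \<B> \<sigma> \<longleftrightarrow>
     G_fin_strategy_One \<A> \<sigma> \<and>
     (\<forall>F :: nat \<Rightarrow> 'b set. (\<forall>n. F n \<in> fin_subsets (\<sigma> (map F [0..<n]))) \<longrightarrow> (\<Union>n. F n) \<notin> \<B>)"


definition Omega_pt :: "'a topology \<Rightarrow> 'a \<Rightarrow> 'a set set" where
  "Omega_pt Z z = {A. A \<subseteq> topspace Z \<and> z \<in> Z closure_of A - A}"

definition countable_fan_tightness :: "'a topology \<Rightarrow> bool" where
  "countable_fan_tightness Z \<longleftrightarrow> (\<forall>z\<in>topspace Z. S_fin (Omega_pt Z z) (Omega_pt Z z))"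

definition Reznichenko_space :: "'a topology \<Rightarrow> bool" where
  "Reznichenko_space Z \<longleftrightarrow>
     (\<forall>z\<in>topspace Z. Omega_pt Z z \<inter> ctbl_subsets (topspace Z) = gp (Omega_pt Z z))"


definition compact_subsets :: "'a topology \<Rightarrow> 'a set set" where
  "compact_subsets X = {K. compactin X K \<and> K \<noteq> {}}"

definition vietoris :: "'a topology \<Rightarrow> 'a set topology" where
  "vietoris X = topology_generated_by
     ({{K \<in> compact_subsets X. K \<subseteq> U} |U. openin X U} \<union>
      {{K \<in> compact_subsets X. K \<inter> U \<noteq> {}} |U. openin X U})"

definition Pfin :: "'a topology \<Rightarrow> 'a set topology" where
  "Pfin X = subtopology (vietoris X) (fin_subsets (topspace X))"

text \<open>Functions on \<open>topspace X\<close> are represented by their extensional versions, as in the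
  library's product topology; in particular the zero function is a restriction.\<close>

definition Cp :: "'a topology \<Rightarrow> ('a \<Rightarrow> real) topology" where
  "Cp X = subtopology (product_topology (\<lambda>_. euclideanreal) (topspace X))
            {f. continuous_map X euclideanreal f}"

definition Cp_zero :: "'a topology \<Rightarrow> 'a \<Rightarrow> real" where
  "Cp_zero X = (\<lambda>x\<in>topspace X. 0)"

definition finite_power :: "'a topology \<Rightarrow> nat \<Rightarrow> (nat \<Rightarrow> 'a) topology" where
  "finite_power X n = product_topology (\<lambda>_. X) {..<n}"


lemma topspace_vietoris: "topspace (vietoris X) = compact_subsets X"
proof
  show "topspace (vietoris X) \<subseteq> compact_subsets X"
    unfolding vietoris_def topology_generated_by_topspace by (rule Union_least) auto
  have "compact_subsets X = {K \<in> compact_subsets X. K \<subseteq> topspace X}"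
    by (auto simp: compact_subsets_def dest: compactin_subset_topspace)
  then have "compact_subsets X \<in> {{K \<in> compact_subsets X. K \<subseteq> U} |U. openin X U}"
    using openin_topspace[of X] by (intro CollectI exI[of _ "topspace X"] conjI)
  then show "compact_subsets X \<subseteq> topspace (vietoris X)"
    unfolding vietoris_def topology_generated_by_topspace by (intro Union_upper UnI1)
qed

lemma topspace_Pfin: "topspace (Pfin X) = fin_subsets (topspace X)"
  unfolding Pfin_def topspace_subtopology topspace_vietoris
  by (auto simp: compact_subsets_def fin_subsets_def finite_imp_compactin)

lemma topspace_Cp:
  "topspace (Cp X) = {f \<in> extensional (topspace X). continuous_map X euclideanreal f}"
  by (auto simp: Cp_def PiE_def)

lemma Cp_zero_in_Cp: "Cp_zero X \<in> topspace (Cp X)"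
proof -
  have "continuous_map X euclideanreal (Cp_zero X)"
    by (rule continuous_map_eq[of _ _ "\<lambda>_. 0"]) (auto simp: Cp_zero_def)
  then show ?thesis
    by (simp add: topspace_Cp Cp_zero_def)
qed

end

theory Submission imports Defs begin

text \<open>
  The finite subsets of \<open>X\<close> translate between \<open>X\<close>, its powers and its function space. A member
  \<open>U\<close> of an omega-cover becomes the open set of all finite subsets of \<open>U\<close>, and these sets cover
  the space of finite sets. The Hurewicz property of that space says a little more than that the
  selected sets form an omega-cover: every finite set is caught at almost all stages. This is what
  groupability asks for, namely that any infinitely many groups suffice, once the finite sets
  selected at different stages are disjoint.

  Disjointness is obtained by playing the selection as a game in which One deletes the moves that
  have been made. Such a game can be won against any strategy for an almost trivial reason
  (\<open>Hurewicz_game\<close>): by the Lindelof property only countably many positions matter, the Hurewicz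
  property answers the covers at all positions at once, and each point is missed at only finitely
  many of them. The same game, with functions close to a given \<open>z\<close> as moves, yields the
  selection principle in the function space at every \<open>z\<close>
  (\<open>S_fin_Omega_pt_Cp\<close>), from which countable fan-tightness and the Reznichenko property follow.

  Conversely, from a groupable selection the groups can be matched with the stages when the
  families decrease (\<open>S_fin_gp_decreasing\<close>), and common refinements make omega-covers decrease. So
  the selection principles for omega-covers and for the function space both give finite selections
  from omega-covers that catch every finite set at almost all stages; for the function space,
  complete regularity supplies functions that vanish on a finite set and are one off a member of
  the cover. A tube argument turns these selections into the Hurewicz property of every finite
  power of \<open>X\<close> (\<open>Hurewicz_power_if_eventual_omega_selections\<close>). As the space of finite sets is a
  countable union of continuous images of finite powers, it is then Hurewicz too, which completes the
  circle.

  The selection principle for the space of finite sets itself is the one of \<open>X\<close> applied to another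
  space. This works because that space is again infinite and T1 and its own finite powers are
  countable unions of continuous images of finite powers of \<open>X\<close>.
\<close>

section \<open>The Hurewicz property for countable families and in a game\<close>

text \<open>A member of a cover that is the whole space settles its cover alone, and empty members
  can be left out; this reduces arbitrary open covers to covers by proper open sets. Since
  ``all but finitely many'' does not depend on an enumeration, any countable index set will do.\<close>

lemma Hurewicz_countable_family:
  fixes N :: "'i \<Rightarrow> 'c \<Rightarrow> 'a set"
  assumes Z: "Hurewicz_space Z" "topspace Z \<noteq> {}" and I: "countable I"
    and op: "\<And>i c. i \<in> I \<Longrightarrow> c \<in> C i \<Longrightarrow> openin Z (N i c)"
    and cov: "\<And>i. i \<in> I \<Longrightarrow> topspace Z \<subseteq> (\<Union>c\<in>C i. N i c)"
  obtains F where "\<And>i. i \<in> I \<Longrightarrow> F i \<in> fin_subsets (C i)"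
    and "\<And>z. z \<in> topspace Z \<Longrightarrow> finite {i\<in>I. z \<notin> (\<Union>c\<in>F i. N i c)}"
proof -
  define B where "B = {i\<in>I. \<exists>c\<in>C i. N i c = topspace Z}"
  define G where "G = I - B"
  have "\<forall>i\<in>B. \<exists>c. c \<in> C i \<and> N i c = topspace Z"
    by (auto simp: B_def)
  then obtain b where b: "\<And>i. i \<in> B \<Longrightarrow> b i \<in> C i \<and> N i (b i) = topspace Z"
    by metis
  have "\<exists>F. (\<forall>i\<in>G. F i \<in> fin_subsets (C i)) \<and>
      (\<forall>z\<in>topspace Z. finite {i\<in>G. z \<notin> (\<Union>c\<in>F i. N i c)})"
  proof (cases "G = {}")
    case False
    have cG: "countable G" using I by (simp add: G_def)
    \<comment> \<open>If \<open>G\<close> is finite, this enumeration repeats its members, so every number has a cover.\<close>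
    define g where "g = from_nat_into G"
    have gG: "g n \<in> G" for n
      using False by (simp add: g_def from_nat_into)
    define \<U> where "\<U> n = N (g n) ` C (g n) - {{}}" for n
    have "\<U> n \<in> open_covers Z" for n
    proof -
      have gI: "g n \<in> I" and nB: "g n \<notin> B" using gG[of n] by (auto simp: G_def)
      have "\<U> n \<subseteq> proper_opens Z"
        using op[OF gI] nB gI by (auto simp: \<U>_def proper_opens_def B_def)
      moreover have "\<Union>(\<U> n) = topspace Z"
      proof
        show "\<Union>(\<U> n) \<subseteq> topspace Z"
          using op[OF gI] by (auto simp: \<U>_def dest: openin_subset)
        show "topspace Z \<subseteq> \<Union>(\<U> n)"
          using cov[OF gI] by (fastforce simp: \<U>_def)
      qed
      ultimately show ?thesis by (simp add: open_covers_def)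
    qed
    then obtain \<F> where \<F>: "\<And>n. \<F> n \<in> fin_subsets (\<U> n)"
      and ev: "\<And>z. z \<in> topspace Z \<Longrightarrow> \<exists>m. \<forall>n\<ge>m. z \<in> \<Union>(\<F> n)"
      using Z(1) unfolding Hurewicz_space_def by metis
    have "\<exists>D. D \<in> fin_subsets (C (g n)) \<and> \<F> n = N (g n) ` D" for n
    proof -
      have "finite (\<F> n)" "\<F> n \<subseteq> N (g n) ` C (g n)" "\<F> n \<noteq> {}"
        using \<F>[of n] by (auto simp: fin_subsets_def \<U>_def)
      then obtain D where "D \<subseteq> C (g n)" "finite D" "\<F> n = N (g n) ` D"
        by (meson finite_subset_image)
      with \<open>\<F> n \<noteq> {}\<close> show ?thesis by (auto simp: fin_subsets_def)
    qed
    then obtain D where D: "\<And>n. D n \<in> fin_subsets (C (g n))" "\<And>n. \<F> n = N (g n) ` D n"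
      by metis
    let ?e = "to_nat_on G"
    have ge: "g (?e i) = i" if "i \<in> G" for i
      using cG that by (simp add: g_def)
    have "finite {i\<in>G. z \<notin> (\<Union>c\<in>D (?e i). N i c)}" if z: "z \<in> topspace Z" for z
    proof -
      obtain m where m: "\<forall>n\<ge>m. z \<in> \<Union>(\<F> n)" using ev[OF z] by blast
      have "{i\<in>G. z \<notin> (\<Union>c\<in>D (?e i). N i c)} \<subseteq> ?e -` {..<m} \<inter> G"
      proof
        fix i assume i: "i \<in> {i\<in>G. z \<notin> (\<Union>c\<in>D (?e i). N i c)}"
        then have "z \<notin> \<Union>(\<F> (?e i))" by (simp add: D(2) ge)
        then have "?e i < m" using m by (meson not_le_imp_less)
        with i show "i \<in> ?e -` {..<m} \<inter> G" by simp
      qed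
      moreover have "finite (?e -` {..<m} \<inter> G)"
        by (rule finite_vimage_IntI) (auto simp: cG inj_on_to_nat_on)
      ultimately show ?thesis by (rule finite_subset)
    qed
    moreover have "D (?e i) \<in> fin_subsets (C i)" if "i \<in> G" for i
      using D(1)[of "?e i"] ge[OF that] by simp
    ultimately show ?thesis by (intro exI[of _ "\<lambda>i. D (?e i)"]) blast
  qed simp
  then obtain F where F: "\<And>i. i \<in> G \<Longrightarrow> F i \<in> fin_subsets (C i)"
      "\<And>z. z \<in> topspace Z \<Longrightarrow> finite {i\<in>G. z \<notin> (\<Union>c\<in>F i. N i c)}" by blast
  define F' where "F' i = (if i \<in> B then {b i} else F i)" for i
  show thesis
  proof (rule that)
    show "F' i \<in> fin_subsets (C i)" if "i \<in> I" for i
      using that F(1) b by (auto simp: F'_def G_def fin_subsets_def)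
    show "finite {i\<in>I. z \<notin> (\<Union>c\<in>F' i. N i c)}" if "z \<in> topspace Z" for z
      by (rule finite_subset[OF _ F(2)[OF that]]) (use b that in \<open>auto simp: F'_def G_def\<close>)
  qed
qed

lemma Hurewicz_sequence:
  fixes N :: "nat \<Rightarrow> 'c \<Rightarrow> 'a set"
  assumes Z: "Hurewicz_space Z" "topspace Z \<noteq> {}"
    and op: "\<And>i c. c \<in> C i \<Longrightarrow> openin Z (N i c)"
    and cov: "\<And>i. topspace Z \<subseteq> (\<Union>c\<in>C i. N i c)"
  shows "\<exists>F. (\<forall>i. F i \<in> fin_subsets (C i)) \<and>
    (\<forall>z\<in>topspace Z. \<exists>m. \<forall>i\<ge>m. \<exists>c\<in>F i. z \<in> N i c)"
proof (rule Hurewicz_countable_family[OF Z, of UNIV C N])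
  fix F assume F: "\<And>i. i \<in> UNIV \<Longrightarrow> F i \<in> fin_subsets (C i)"
    and fin: "\<And>z. z \<in> topspace Z \<Longrightarrow> finite {i\<in>UNIV. z \<notin> (\<Union>c\<in>F i. N i c)}"
  have "\<exists>m. \<forall>i\<ge>m. \<exists>c\<in>F i. z \<in> N i c" if z: "z \<in> topspace Z" for z
  proof -
    obtain m where "\<forall>i\<in>{i\<in>UNIV. z \<notin> (\<Union>c\<in>F i. N i c)}. i < m"
      using fin[OF z] finite_nat_set_iff_bounded by blast
    then have "\<forall>i\<ge>m. \<exists>c\<in>F i. z \<in> N i c" by force
    then show ?thesis by blast
  qed
  with F show ?thesis by blast
qed (use op cov in simp_all)

text \<open>In the game the covers may depend on the moves made so far. By the Lindelof property One
  can be held to countable covers, so that only countably many positions can occur. The Hurewicz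
  property answers all of their covers simultaneously, every point being missed at only finitely
  many positions; playing by these answers visits each position at most once.\<close>

lemma Hurewicz_game:
  fixes C :: "'b set list \<Rightarrow> 'b set" and N :: "'b set list \<Rightarrow> 'b \<Rightarrow> 'a set"
  assumes Z: "Hurewicz_space Z" "topspace Z \<noteq> {}"
    and step: "\<And>s D. s \<in> lists M \<Longrightarrow> D \<in> fin_subsets (C s) \<Longrightarrow> D \<in> M"
    and op: "\<And>s c. s \<in> lists M \<Longrightarrow> c \<in> C s \<Longrightarrow> openin Z (N s c)"
    and cov: "\<And>s. s \<in> lists M \<Longrightarrow> topspace Z \<subseteq> (\<Union>c\<in>C s. N s c)"
  obtains F :: "nat \<Rightarrow> 'b set"
  where "\<And>n. F n \<in> fin_subsets (C (map F [0..<n]))"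
    and "\<And>n. map F [0..<n] \<in> lists M"
    and "\<And>z. z \<in> topspace Z \<Longrightarrow> \<exists>m. \<forall>n\<ge>m. \<exists>c\<in>F n. z \<in> N (map F [0..<n]) c"
proof -
  have "\<exists>C'. countable C' \<and> C' \<subseteq> C s \<and> topspace Z \<subseteq> (\<Union>c\<in>C'. N s c)"
    if s: "s \<in> lists M" for s
  proof -
    obtain F :: "nat \<Rightarrow> 'b set" where F: "\<And>i. F i \<in> fin_subsets (C s)"
      "\<And>z. z \<in> topspace Z \<Longrightarrow> \<exists>m. \<forall>i\<ge>m. \<exists>c\<in>F i. z \<in> N s c"
      using Hurewicz_sequence[OF Z op[OF s] cov[OF s]] by blast
    have "\<exists>i. z \<in> (\<Union>c\<in>F i. N s c)" if "z \<in> topspace Z" for z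
      using F(2)[OF that] by blast
    moreover have "countable (F i)" for i
      using F(1)[of i] by (simp add: fin_subsets_def countable_finite)
    then have "countable (\<Union>i. F i)" by simp
    moreover have "(\<Union>i. F i) \<subseteq> C s" using F(1) by (auto simp: fin_subsets_def)
    ultimately show ?thesis by (intro exI[of _ "\<Union>i. F i"]) auto
  qed
  then obtain C' where C': "\<And>s. s \<in> lists M \<Longrightarrow> countable (C' s)"
      "\<And>s. s \<in> lists M \<Longrightarrow> C' s \<subseteq> C s"
      "\<And>s. s \<in> lists M \<Longrightarrow> topspace Z \<subseteq> (\<Union>c\<in>C' s. N s c)"
    by metis
  \<comment> \<open>The tree of positions that can arise while Two plays finite subsets of the countable subcovers.\<close>
  define T where "T = rec_nat {[]} (\<lambda>_ S. \<Union>s\<in>S. (\<lambda>D. s @ [D]) ` fin_subsets (C' s))"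
  have T0: "T 0 = {[]}" and TS: "\<And>n. T (Suc n) = (\<Union>s\<in>T n. (\<lambda>D. s @ [D]) ` fin_subsets (C' s))"
    by (simp_all add: T_def)
  have TM: "T n \<subseteq> lists M" for n
  proof (induction n)
    case (Suc n)
    have "D \<in> M" if "s \<in> T n" "D \<in> fin_subsets (C' s)" for s D
      using that step[of s D] Suc C'(2)[of s] by (auto simp: fin_subsets_def)
    moreover have "s \<in> lists M" if "s \<in> T n" for s using that Suc by blast
    ultimately have "s @ [D] \<in> lists M" if "s \<in> T n" "D \<in> fin_subsets (C' s)" for s D
      using that by simp
    then show ?case unfolding TS by blast
  qed (simp add: T0)
  have cT: "countable (T n)" for n
  proof (induction n)
    case (Suc n)
    have "countable (fin_subsets (C' s))" if "s \<in> T n" for s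
    proof (rule countable_subset)
      show "countable {A. finite A \<and> A \<subseteq> C' s}"
        using TM[of n] that by (intro countable_Collect_finite_subset C'(1)) blast
    qed (auto simp: fin_subsets_def)
    then show ?case unfolding TS using Suc by (intro countable_UN countable_image) auto
  qed (simp add: T0)
  define I where "I = (\<Union>n. T n)"
  have cI: "countable I" using cT by (simp add: I_def)
  have IM: "s \<in> lists M" if "s \<in> I" for s
    using that TM unfolding I_def by blast
  obtain R where R: "\<And>s. s \<in> I \<Longrightarrow> R s \<in> fin_subsets (C' s)"
    "\<And>z. z \<in> topspace Z \<Longrightarrow> finite {s\<in>I. z \<notin> (\<Union>c\<in>R s. N s c)}"
  proof (rule Hurewicz_countable_family[OF Z cI, of C' N])
    show "openin Z (N s c)" if "s \<in> I" "c \<in> C' s" for s c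
      using that IM C'(2) op by blast
    show "topspace Z \<subseteq> (\<Union>c\<in>C' s. N s c)" if "s \<in> I" for s
      using that IM C'(3) by blast
  qed blast
  \<comment> \<open>The branch along which Two gives at each position the answer chosen for it.\<close>
  define p where "p = rec_nat [] (\<lambda>_ s. s @ [R s])"
  have p0: "p 0 = []" and pS: "\<And>n. p (Suc n) = p n @ [R (p n)]"
    by (simp_all add: p_def)
  have pT: "p n \<in> T n" for n
  proof (induction n)
    case (Suc n)
    then have "R (p n) \<in> fin_subsets (C' (p n))" by (intro R(1)) (auto simp: I_def)
    with Suc show ?case by (auto simp: TS pS)
  qed (simp add: p0 T0)
  then have pI: "p n \<in> I" for n by (auto simp: I_def)
  define F where "F n = R (p n)" for n
  have mapF: "map F [0..<n] = p n" for n
    by (induction n) (auto simp: p0 pS F_def)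
  have "length (p n) = n" for n by (metis mapF diff_zero length_map length_upt)
  then have inj: "inj p" by (metis injI)
  show thesis
  proof (rule that)
    show "F n \<in> fin_subsets (C (map F [0..<n]))" for n
      using R(1)[OF pI[of n]] C'(2)[OF IM[OF pI[of n]]] unfolding mapF
      by (auto simp: F_def fin_subsets_def)
    show "map F [0..<n] \<in> lists M" for n unfolding mapF by (rule IM[OF pI])
    fix z assume z: "z \<in> topspace Z"
    have "finite (p -` {s\<in>I. z \<notin> (\<Union>c\<in>R s. N s c)})"
      by (rule finite_vimageI[OF R(2)[OF z] inj])
    then obtain m where "\<forall>n \<in> p -` {s\<in>I. z \<notin> (\<Union>c\<in>R s. N s c)}. n < m"
      using finite_nat_set_iff_bounded by blast
    then have "\<forall>n\<ge>m. z \<in> (\<Union>c\<in>R (p n). N (p n) c)" using pI by fastforce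
    then show "\<exists>m. \<forall>n\<ge>m. \<exists>c\<in>F n. z \<in> N (map F [0..<n]) c"
      unfolding mapF F_def by blast
  qed
qed

text \<open>Groupings need disjoint groups. If no finite set of moves matters for One's covers, then
  Two can be kept from repeating a move by deleting the moves already made.\<close>

lemma Hurewicz_game_disjoint:
  fixes C :: "'b set list \<Rightarrow> 'b set" and N :: "'b set list \<Rightarrow> 'b \<Rightarrow> 'a set"
  assumes Z: "Hurewicz_space Z" "topspace Z \<noteq> {}"
    and fin: "\<And>D. D \<in> M \<Longrightarrow> finite D"
    and step: "\<And>s D. s \<in> lists M \<Longrightarrow> D \<in> fin_subsets (C s) \<Longrightarrow> D \<in> M"
    and op: "\<And>s c. s \<in> lists M \<Longrightarrow> c \<in> C s \<Longrightarrow> openin Z (N s c)"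
    and cov: "\<And>s D. s \<in> lists M \<Longrightarrow> finite D \<Longrightarrow> topspace Z \<subseteq> (\<Union>c\<in>C s - D. N s c)"
  obtains F :: "nat \<Rightarrow> 'b set"
  where "\<And>n. F n \<in> fin_subsets (C (map F [0..<n]))"
    and "\<And>n. map F [0..<n] \<in> lists M"
    and "disjoint_family F"
    and "\<And>z. z \<in> topspace Z \<Longrightarrow> \<exists>m. \<forall>n\<ge>m. \<exists>c\<in>F n. z \<in> N (map F [0..<n]) c"
proof -
  obtain F :: "nat \<Rightarrow> 'b set"
    where F: "\<And>n. F n \<in> fin_subsets (C (map F [0..<n]) - \<Union>(set (map F [0..<n])))"
      "\<And>n. map F [0..<n] \<in> lists M"
      "\<And>z. z \<in> topspace Z \<Longrightarrow> \<exists>m. \<forall>n\<ge>m. \<exists>c\<in>F n. z \<in> N (map F [0..<n]) c"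
  proof (rule Hurewicz_game[OF Z, of M "\<lambda>s. C s - \<Union>(set s)" N])
    show "D \<in> M" if "s \<in> lists M" "D \<in> fin_subsets (C s - \<Union>(set s))" for s D
      using step[of s D] that by (auto simp: fin_subsets_def)
    show "openin Z (N s c)" if "s \<in> lists M" "c \<in> C s - \<Union>(set s)" for s c
      using op that by blast
    show "topspace Z \<subseteq> (\<Union>c\<in>C s - \<Union>(set s). N s c)" if "s \<in> lists M" for s
      using that fin by (intro cov) auto
  qed blast
  have "F m \<inter> F n = {}" if "m < n" for m n
    using F(1)[of n] that by (fastforce simp: fin_subsets_def)
  then have "disjoint_family F"
    unfolding disjoint_family_on_def by (metis Int_commute linorder_neqE_nat)
  moreover have "F n \<in> fin_subsets (C (map F [0..<n]))" for n
    using F(1)[of n] by (auto simp: fin_subsets_def)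
  ultimately show thesis using that F by blast
qed

section \<open>Groupable families\<close>

text \<open>A member of the union is put into the group given by the unique stage that contains it.\<close>

lemma disjoint_union_groupable:
  fixes F :: "nat \<Rightarrow> 'b set"
  assumes fin: "\<And>n. finite (F n)" and disj: "disjoint_family F"
    and C: "\<And>J. infinite J \<Longrightarrow> (\<Union>n\<in>J. F n) \<in> \<CC>"
  shows "(\<Union>n. F n) \<in> gp \<CC>"
proof -
  define \<phi> where "\<phi> c = (THE n. c \<in> F n)" for c
  have \<phi>: "\<phi> c = n" if "c \<in> F n" for c n
    unfolding \<phi>_def
  proof (rule the_equality)
    show "m = n" if "c \<in> F m" for m
      using that \<open>c \<in> F n\<close> disj by (auto simp: disjoint_family_on_def)
  qed fact
  have eq: "{c \<in> (\<Union>n. F n). \<phi> c = n} = F n" for n using \<phi> by auto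
  have "groupable_in \<CC> (\<Union>n. F n)"
    unfolding groupable_in_def
  proof (intro exI[of _ \<phi>] conjI allI impI)
    show "finite {c \<in> (\<Union>n. F n). \<phi> c = n}" for n unfolding eq by (rule fin)
    show "(\<Union>n\<in>J. {c \<in> (\<Union>n. F n). \<phi> c = n}) \<in> \<CC>" if "infinite J" for J
      unfolding eq using that by (rule C)
  qed
  then show ?thesis using C[of UNIV] by (simp add: gp_def)
qed

lemma gp_grouping:
  assumes "C \<in> gp \<CC>"
  shows "\<exists>\<phi> :: 'b \<Rightarrow> nat. (\<forall>n. finite {c\<in>C. \<phi> c = n}) \<and>
    (\<forall>J. infinite J \<longrightarrow> (\<Union>n\<in>J. {c\<in>C. \<phi> c = n}) \<in> \<CC>)"
  using assms by (simp add: gp_def groupable_in_def)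

lemma S_fin_mono: "S_fin \<A> \<B> \<Longrightarrow> \<B> \<subseteq> \<B>' \<Longrightarrow> S_fin \<A> \<B>'"
  unfolding S_fin_def by blast

text \<open>For a decreasing sequence of families, the groups of the selected union can be matched with
  the indices: only finitely many members of the union are selected before stage \<open>m\<close>, hence almost
  all groups lie within the \<open>m\<close>-th family, and a group for index \<open>m\<close> can be picked from them.\<close>

lemma S_fin_gp_decreasing:
  fixes A :: "nat \<Rightarrow> 'b set"
  assumes S: "S_fin \<A> (gp \<B>)" and A: "\<And>m. A m \<in> \<A>" and dec: "\<And>m n. m \<le> n \<Longrightarrow> A n \<subseteq> A m"
  obtains G where "\<And>m. finite (G m)" "\<And>m. G m \<subseteq> A m" "\<And>J. infinite J \<Longrightarrow> (\<Union>m\<in>J. G m) \<in> \<B>"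
proof -
  obtain F where F: "\<And>n. F n \<in> fin_subsets (A n)" and U: "(\<Union>n. F n) \<in> gp \<B>"
    using S[unfolded S_fin_def, rule_format, of A] A by blast
  from gp_grouping[OF U] obtain \<phi> :: "'b \<Rightarrow> nat" where fin: "\<forall>n. finite {c\<in>(\<Union>n. F n). \<phi> c = n}"
    and B: "\<forall>J. infinite J \<longrightarrow> (\<Union>n\<in>J. {c\<in>(\<Union>n. F n). \<phi> c = n}) \<in> \<B>"
    by (elim exE conjE)
  let ?K = "\<lambda>k. {c\<in>(\<Union>n. F n). \<phi> c = k}"
  have ev: "\<exists>k>l. ?K k \<subseteq> A m" for m l
  proof -
    have "finite (F i)" for i using F[of i] by (simp add: fin_subsets_def)
    then have "finite (\<phi> ` (\<Union>i<m. F i))" by simp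
    from this[unfolded finite_nat_set_iff_bounded]
    obtain b where b: "\<forall>k \<in> \<phi> ` (\<Union>i<m. F i). k < b" ..
    let ?k = "max b (Suc l)"
    have "c \<in> A m" if "c \<in> F i" "\<phi> c = ?k" for c i
    proof -
      have "\<not> i < m"
      proof
        assume "i < m"
        then have "\<phi> c \<in> \<phi> ` (\<Union>i<m. F i)" using \<open>c \<in> F i\<close> by blast
        then have "\<phi> c < b" using b by blast
        then show False using that(2) by simp
      qed
      then have "A i \<subseteq> A m" by (intro dec) simp
      moreover have "F i \<subseteq> A i" using F[of i] by (simp add: fin_subsets_def)
      ultimately show ?thesis using that(1) by blast
    qed
    then show ?thesis by (intro exI[of _ ?k]) auto
  qed
  have "\<exists>k. \<forall>m. ?K (k m) \<subseteq> A m \<and> k m < k (Suc m)"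
  proof (rule dependent_nat_choice)
    show "\<exists>k. ?K k \<subseteq> A 0" using ev[of 0 0] by blast
    show "\<exists>k'. ?K k' \<subseteq> A (Suc m) \<and> k < k'" for k m using ev[of k "Suc m"] by blast
  qed
  then obtain k where k: "\<And>m. ?K (k m) \<subseteq> A m" "\<And>m. k m < k (Suc m)" by blast
  have inj: "inj k" by (rule strict_mono_imp_inj_on) (use k(2) in \<open>simp add: strict_mono_Suc_iff\<close>)
  show thesis
  proof (rule that)
    show "finite (?K (k m))" for m by (rule fin[rule_format])
    show "?K (k m) \<subseteq> A m" for m by (rule k(1))
    fix J :: "nat set" assume "infinite J"
    then have "infinite (k ` J)" using inj by (simp add: finite_image_iff inj_on_subset)
    from B[rule_format, OF this] show "(\<Union>m\<in>J. ?K (k m)) \<in> \<B>" by simp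
  qed
qed

lemma cofinite_if_every_infinite_set_meets:
  assumes "\<And>J :: nat set. infinite J \<Longrightarrow> \<exists>n\<in>J. P n"
  shows "\<exists>m. \<forall>n\<ge>m. P n"
proof -
  have "finite {n. \<not> P n}" using assms[of "{n. \<not> P n}"] by blast
  then obtain m where "\<forall>n\<in>{n. \<not> P n}. n < m" using finite_nat_set_iff_bounded by blast
  then show ?thesis by (metis mem_Collect_eq not_le)
qed

section \<open>Spaces of finite sets\<close>

lemma openin_Pfin_subset:
  assumes "openin X U"
  shows "openin (Pfin X) {F \<in> fin_subsets (topspace X). F \<subseteq> U}"
proof -
  have "openin (vietoris X) {K \<in> compact_subsets X. K \<subseteq> U}"
    unfolding vietoris_def by (rule topology_generated_by_Basis) (use assms in blast)
  moreover have "{F \<in> fin_subsets (topspace X). F \<subseteq> U}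
      = {K \<in> compact_subsets X. K \<subseteq> U} \<inter> fin_subsets (topspace X)"
    by (auto simp: compact_subsets_def fin_subsets_def finite_imp_compactin)
  ultimately show ?thesis unfolding Pfin_def by (auto simp: openin_subtopology)
qed

lemma openin_Pfin_hit:
  assumes "openin X U"
  shows "openin (Pfin X) {F \<in> fin_subsets (topspace X). F \<inter> U \<noteq> {}}"
proof -
  have "openin (vietoris X) {K \<in> compact_subsets X. K \<inter> U \<noteq> {}}"
    unfolding vietoris_def by (rule topology_generated_by_Basis) (use assms in blast)
  moreover have "{F \<in> fin_subsets (topspace X). F \<inter> U \<noteq> {}}
      = {K \<in> compact_subsets X. K \<inter> U \<noteq> {}} \<inter> fin_subsets (topspace X)"
    by (auto simp: compact_subsets_def fin_subsets_def finite_imp_compactin)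
  ultimately show ?thesis unfolding Pfin_def by (auto simp: openin_subtopology)
qed

lemma openin_T1_diff_finite:
  assumes "t1_space X" "openin X U" "finite F"
  shows "openin X (U - F)"
proof -
  have "closedin X (topspace X \<inter> F)"
    using assms(1,3) by (simp add: t1_space_closedin_finite)
  then have "openin X (U - (topspace X \<inter> F))" using assms(2) by (rule openin_diff[rotated])
  moreover have "U - (topspace X \<inter> F) = U - F" using openin_subset[OF assms(2)] by auto
  ultimately show ?thesis by simp
qed

text \<open>A finite set \<open>F\<close> is separated from \<open>G\<close> either by avoiding a point of \<open>G\<close> outside \<open>F\<close> or by
  hitting the complement of \<open>G\<close>.\<close>

lemma t1_space_Pfin:
  assumes "t1_space X"
  shows "t1_space (Pfin X)"
  unfolding t1_space_def topspace_Pfin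
proof (intro ballI impI)
  fix F G assume F: "F \<in> fin_subsets (topspace X)" and G: "G \<in> fin_subsets (topspace X)" and "F \<noteq> G"
  from \<open>F \<noteq> G\<close> consider x where "x \<in> G" "x \<notin> F" | "\<not> F \<subseteq> G" by blast
  then show "\<exists>U. openin (Pfin X) U \<and> F \<in> U \<and> G \<notin> U"
  proof cases
    case 1
    have "openin X (topspace X - {x})" using assms by (intro openin_T1_diff_finite) auto
    from openin_Pfin_subset[OF this] show ?thesis
      using 1 F by (intro exI conjI) (auto simp: fin_subsets_def)
  next
    case 2
    have "openin X (topspace X - G)"
      using assms G by (intro openin_T1_diff_finite) (auto simp: fin_subsets_def)
    from openin_Pfin_hit[OF this] show ?thesis
      using 2 F by (intro exI conjI) (auto simp: fin_subsets_def)
  qed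
qed

lemma infinite_Pfin:
  assumes "infinite (topspace X)"
  shows "infinite (topspace (Pfin X))"
proof
  assume "finite (topspace (Pfin X))"
  moreover have "(\<lambda>x. {x}) ` topspace X \<subseteq> topspace (Pfin X)"
    by (auto simp: topspace_Pfin fin_subsets_def)
  ultimately have "finite ((\<lambda>x. {x}) ` topspace X)" by (rule finite_subset[rotated])
  then show False using assms by (auto dest: finite_imageD)
qed

lemma topspace_Pfin_nonempty:
  assumes "topspace X \<noteq> {}"
  shows "topspace (Pfin X) \<noteq> {}"
proof -
  obtain x where "x \<in> topspace X" using assms by blast
  then have "{x} \<in> topspace (Pfin X)" by (simp add: topspace_Pfin fin_subsets_def)
  then show ?thesis by blast
qed

lemma continuous_map_coordinate_set:
  assumes "n \<ge> 1"
  shows "continuous_map (finite_power X n) (Pfin X) (\<lambda>p. p ` {..<n})"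
proof -
  let ?P = "finite_power X n"
  have ts: "topspace ?P = (\<Pi>\<^sub>E i\<in>{..<n}. topspace X)" by (simp add: finite_power_def)
  have proj: "openin ?P {p \<in> topspace ?P. p i \<in> U}" if "openin X U" "i < n" for U i
  proof (rule openin_continuous_map_preimage[OF _ that(1)])
    show "continuous_map ?P X (\<lambda>p. p i)"
      unfolding finite_power_def by (rule continuous_map_product_projection) (use that(2) in simp)
  qed
  have fin: "p ` {..<n} \<in> fin_subsets (topspace X)" if "p \<in> topspace ?P" for p
    using that assms by (auto simp: ts fin_subsets_def lessThan_empty_iff PiE_mem)
  have comp: "p ` {..<n} \<in> compact_subsets X" if "p \<in> topspace ?P" for p
    using fin[OF that] by (auto simp: compact_subsets_def fin_subsets_def finite_imp_compactin)
  have "continuous_map ?P (vietoris X) (\<lambda>p. p ` {..<n})"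
    unfolding vietoris_def
  proof (rule continuous_on_generated_topo)
    fix W assume "W \<in> {{K \<in> compact_subsets X. K \<subseteq> U} |U. openin X U} \<union>
      {{K \<in> compact_subsets X. K \<inter> U \<noteq> {}} |U. openin X U}"
    then consider U where "openin X U" "W = {K \<in> compact_subsets X. K \<subseteq> U}"
      | U where "openin X U" "W = {K \<in> compact_subsets X. K \<inter> U \<noteq> {}}" by blast
    then show "openin ?P ((\<lambda>p. p ` {..<n}) -` W \<inter> topspace ?P)"
    proof cases
      case 1
      have "openin ?P (\<Inter>i\<in>{..<n}. {p \<in> topspace ?P. p i \<in> U})"
        using proj[OF 1(1)] assms by (intro openin_Inter) (auto simp: lessThan_empty_iff)
      moreover have "(\<lambda>p. p ` {..<n}) -` W \<inter> topspace ?P = (\<Inter>i\<in>{..<n}. {p \<in> topspace ?P. p i \<in> U})"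
        using comp assms unfolding 1(2) by (auto simp: Suc_le_eq)
      ultimately show ?thesis by simp
    next
      case 2
      have "openin ?P (\<Union>i\<in>{..<n}. {p \<in> topspace ?P. p i \<in> U})"
        using proj[OF 2(1)] by (intro openin_Union) auto
      moreover have "(\<lambda>p. p ` {..<n}) -` W \<inter> topspace ?P = (\<Union>i\<in>{..<n}. {p \<in> topspace ?P. p i \<in> U})"
        using comp unfolding 2(2) by auto
      ultimately show ?thesis by simp
    qed
  next
    show "(\<lambda>p. p ` {..<n}) ` topspace ?P \<subseteq>
      \<Union>({{K \<in> compact_subsets X. K \<subseteq> U} |U. openin X U} \<union>
        {{K \<in> compact_subsets X. K \<inter> U \<noteq> {}} |U. openin X U})"
      using comp topspace_vietoris[of X] unfolding vietoris_def topology_generated_by_topspace by blast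
  qed
  then show ?thesis unfolding Pfin_def using fin by (auto simp: continuous_map_in_subtopology)
qed

lemma finite_set_as_coordinate_set:
  assumes "finite A" "A \<noteq> {}" "card A \<le> n"
  shows "\<exists>g. g ` {..<n} = A"
proof -
  obtain h where h: "bij_betw h {..<card A} A"
    using assms(1) by (metis ex_bij_betw_nat_finite atLeast0LessThan)
  obtain a where a: "a \<in> A" using assms(2) by blast
  have h': "h ` {..<card A} = A" using h by (simp add: bij_betw_def)
  let ?g = "\<lambda>i. if i < card A then h i else a"
  have "?g ` {..<n} \<subseteq> A"
  proof
    fix y assume "y \<in> ?g ` {..<n}"
    then obtain i where "y = ?g i" by blast
    then show "y \<in> A" using a bij_betwE[OF h] by (cases "i < card A") simp_all
  qed
  moreover have "A \<subseteq> ?g ` {..<n}"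
  proof
    fix y assume "y \<in> A"
    then have "y \<in> h ` {..<card A}" by (subst h')
    then obtain i where i: "i < card A" "y = h i" by blast
    then have "i < n" using assms(3) by linarith
    with i show "y \<in> ?g ` {..<n}" by (intro image_eqI[of _ _ i]) simp_all
  qed
  ultimately show ?thesis by blast
qed

section \<open>From finite powers to spaces of finite sets\<close>

lemma topspace_finite_power_nonempty: "topspace X \<noteq> {} \<Longrightarrow> topspace (finite_power X n) \<noteq> {}"
  by (auto simp: finite_power_def PiE_eq_empty_iff)

text \<open>The pieces are treated separately, and stage \<open>m\<close> merges the selections made for pieces
  \<open>0, \<dots>, m\<close>. A point in piece \<open>n\<close> is then covered from the stage on at which its own
  selections cover it and piece \<open>n\<close> has been merged.\<close>

lemma Hurewicz_countable_union_of_images: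
  fixes W :: "nat \<Rightarrow> 'b topology" and Z :: "'a topology"
  assumes W: "\<And>n. Hurewicz_space (W n)" "\<And>n. topspace (W n) \<noteq> {}"
    and f: "\<And>n. continuous_map (W n) Z (f n)"
    and sur: "topspace Z \<subseteq> (\<Union>n. f n ` topspace (W n))"
  shows "Hurewicz_space Z"
  unfolding Hurewicz_space_def
proof (intro allI impI)
  fix \<U> :: "nat \<Rightarrow> 'a set set" assume U: "\<forall>n. \<U> n \<in> open_covers Z"
  define Q where "Q n F \<longleftrightarrow> (\<forall>i. F i \<in> fin_subsets (\<U> i)) \<and>
      (\<forall>w\<in>topspace (W n). \<exists>m. \<forall>i\<ge>m. \<exists>V\<in>F i. w \<in> {x\<in>topspace (W n). f n x \<in> V})"
    for n and F :: "nat \<Rightarrow> 'a set set"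
  have "\<exists>F. Q n F" for n
    unfolding Q_def
  proof (rule Hurewicz_sequence[OF W(1) W(2)])
    show "openin (W n) {x \<in> topspace (W n). f n x \<in> V}" if "V \<in> \<U> i" for i V
    proof (rule openin_continuous_map_preimage[OF f])
      have "\<U> i \<subseteq> proper_opens Z" using U by (simp add: open_covers_def)
      then show "openin Z V" using that by (auto simp: proper_opens_def)
    qed
    show "topspace (W n) \<subseteq> (\<Union>V\<in>\<U> i. {x\<in>topspace (W n). f n x \<in> V})" for i
    proof
      fix x assume x: "x \<in> topspace (W n)"
      then have "f n x \<in> topspace Z" using f[of n] by (auto simp: continuous_map_def)
      also have "topspace Z = \<Union>(\<U> i)" using U by (simp add: open_covers_def)
      finally show "x \<in> (\<Union>V\<in>\<U> i. {x\<in>topspace (W n). f n x \<in> V})" using x by blast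
    qed
  qed
  then obtain F where Q: "\<And>n. Q n (F n)" by metis
  have F: "F n i \<in> fin_subsets (\<U> i)" for n i
    using Q[of n] unfolding Q_def by blast
  have ev: "\<exists>m. \<forall>i\<ge>m. \<exists>V\<in>F n i. w \<in> {x\<in>topspace (W n). f n x \<in> V}"
    if "w \<in> topspace (W n)" for n w
    using Q[of n] that unfolding Q_def by blast
  let ?H = "\<lambda>m. \<Union>n\<le>m. F n m"
  have "\<exists>m. \<forall>i\<ge>m. z \<in> \<Union>(?H i)" if z: "z \<in> topspace Z" for z
  proof -
    obtain n w where w: "w \<in> topspace (W n)" "z = f n w" using sur z by blast
    obtain b where b: "\<forall>i\<ge>b. \<exists>V\<in>F n i. w \<in> {x\<in>topspace (W n). f n x \<in> V}"
      using ev[OF w(1)] by blast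
    have "z \<in> \<Union>(?H i)" if "i \<ge> max b n" for i
    proof -
      obtain V where "V \<in> F n i" "z \<in> V" using b w(2) \<open>i \<ge> max b n\<close> by fastforce
      moreover have "n \<le> i" using \<open>i \<ge> max b n\<close> by simp
      ultimately show ?thesis by blast
    qed
    then show ?thesis by blast
  qed
  moreover have "?H m \<in> fin_subsets (\<U> m)" for m
    using F[of _ m] by (fastforce simp: fin_subsets_def)
  ultimately show "\<exists>\<F>. (\<forall>n. \<F> n \<in> fin_subsets (\<U> n)) \<and>
        (\<forall>z\<in>topspace Z. \<exists>m. \<forall>n\<ge>m. z \<in> \<Union>(\<F> n))"
    by (intro exI[of _ ?H]) blast
qed

lemma Hurewicz_Pfin_if_powers:
  assumes H: "\<forall>n\<ge>1. Hurewicz_space (finite_power X n)" and ne: "topspace X \<noteq> {}"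
  shows "Hurewicz_space (Pfin X)"
proof (rule Hurewicz_countable_union_of_images)
  show "Hurewicz_space (finite_power X (Suc n))" for n using H by simp
  show "topspace (finite_power X (Suc n)) \<noteq> {}" for n
    by (rule topspace_finite_power_nonempty[OF ne])
  show "continuous_map (finite_power X (Suc n)) (Pfin X) (\<lambda>p. p ` {..<Suc n})" for n
    by (rule continuous_map_coordinate_set) simp
  show "topspace (Pfin X) \<subseteq> (\<Union>n. (\<lambda>p. p ` {..<Suc n}) ` topspace (finite_power X (Suc n)))"
  proof
    fix F assume "F \<in> topspace (Pfin X)"
    then have F: "F \<subseteq> topspace X" "finite F" "F \<noteq> {}" by (auto simp: topspace_Pfin fin_subsets_def)
    obtain n where "card F \<le> Suc n" using le_SucI by blast
    then obtain g where g: "g ` {..<Suc n} = F" using finite_set_as_coordinate_set F by metis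
    have "restrict g {..<Suc n} \<in> topspace (finite_power X (Suc n))"
      using g F by (auto simp: finite_power_def)
    moreover have "F = restrict g {..<Suc n} ` {..<Suc n}" using g by simp
    ultimately show "F \<in> (\<Union>n. (\<lambda>p. p ` {..<Suc n}) ` topspace (finite_power X (Suc n)))" by blast
  qed
qed

text \<open>A tuple of \<open>n\<close> finite sets, each with at most \<open>b + 1\<close> points, is read off from a single tuple
  of length \<open>n * (b + 1)\<close>, cut into blocks; the block number and the place within the block are
  quotient and remainder.\<close>

lemma Hurewicz_powers_Pfin:
  assumes H: "\<forall>n\<ge>1. Hurewicz_space (finite_power X n)" and ne: "topspace X \<noteq> {}" and n: "n \<ge> 1"
  shows "Hurewicz_space (finite_power (Pfin X) n)"
proof (rule Hurewicz_countable_union_of_images)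
  let ?W = "\<lambda>b. finite_power X (n * Suc b)"
  let ?f = "\<lambda>b p. \<lambda>i\<in>{..<n}. (\<lambda>j\<in>{..<Suc b}. p (i * Suc b + j)) ` {..<Suc b}"
  have idx: "i * Suc b + j < n * Suc b" if "i < n" "j < Suc b" for i j b
  proof -
    have "i * Suc b + j < Suc i * Suc b" using that by simp
    also have "\<dots> \<le> n * Suc b" using that by (intro mult_le_mono1) simp
    finally show ?thesis .
  qed
  show "Hurewicz_space (?W b)" for b using H n by simp
  show "topspace (?W b) \<noteq> {}" for b by (rule topspace_finite_power_nonempty[OF ne])
  show "continuous_map (?W b) (finite_power (Pfin X) n) (?f b)" for b
  proof -
    have "continuous_map (?W b) (Pfin X) (\<lambda>p. (\<lambda>j\<in>{..<Suc b}. p (i * Suc b + j)) ` {..<Suc b})"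
      if i: "i < n" for i
    proof -
      have "continuous_map (?W b) X (\<lambda>p. p (i * Suc b + j))" if "j < Suc b" for j
        unfolding finite_power_def
        by (rule continuous_map_product_projection) (use idx i that in blast)
      then have "continuous_map (?W b) (finite_power X (Suc b)) (\<lambda>p. \<lambda>j\<in>{..<Suc b}. p (i * Suc b + j))"
        unfolding finite_power_def[of X "Suc b"] continuous_map_componentwise
        by (auto intro: continuous_map_eq)
      from continuous_map_compose[OF this continuous_map_coordinate_set]
      show ?thesis by (simp add: o_def)
    qed
    then show ?thesis
      unfolding finite_power_def[of "Pfin X"] continuous_map_componentwise
      by (auto intro: continuous_map_eq)
  qed
  show "topspace (finite_power (Pfin X) n) \<subseteq> (\<Union>b. ?f b ` topspace (?W b))"
  proof
    fix A assume A: "A \<in> topspace (finite_power (Pfin X) n)"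
    then have ext: "A \<in> extensional {..<n}"
      and Ai: "\<And>i. i < n \<Longrightarrow> A i \<subseteq> topspace X \<and> finite (A i) \<and> A i \<noteq> {}"
      by (auto simp: finite_power_def topspace_Pfin fin_subsets_def PiE_iff)
    define b where "b = Max ((\<lambda>i. card (A i)) ` {..<n})"
    have "card (A i) \<le> Suc b" if "i < n" for i
      unfolding b_def using that by (intro le_SucI Max_ge) auto
    then have "\<forall>i\<in>{..<n}. \<exists>g. g ` {..<Suc b} = A i"
      using Ai finite_set_as_coordinate_set by (metis lessThan_iff)
    then obtain g where g: "\<And>i. i < n \<Longrightarrow> g i ` {..<Suc b} = A i" by (metis lessThan_iff)
    define p where "p = (\<lambda>k\<in>{..<n * Suc b}. g (k div Suc b) (k mod Suc b))"
    have p: "p (i * Suc b + j) = g i j" if "i < n" "j < Suc b" for i j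
      using that idx[OF that] by (simp add: p_def del: mult_Suc_right)
    have "p \<in> topspace (?W b)"
    proof -
      have "g (k div Suc b) (k mod Suc b) \<in> topspace X" if "k < n * Suc b" for k
      proof -
        have "k div Suc b < n" using that by (simp add: less_mult_imp_div_less del: mult_Suc_right)
        moreover have "k mod Suc b < Suc b" by simp
        ultimately show ?thesis using g Ai by blast
      qed
      then show ?thesis by (auto simp: finite_power_def p_def)
    qed
    moreover have "A = ?f b p"
    proof (rule extensionalityI[OF ext])
      fix i assume "i \<in> {..<n}"
      then have i: "i < n" by simp
      have "(\<lambda>j\<in>{..<Suc b}. p (i * Suc b + j)) ` {..<Suc b} = g i ` {..<Suc b}"
        using p[OF i] by (intro image_cong) (simp_all del: mult_Suc_right)
      then show "A i = ?f b p i"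
        using g[OF i] i by (simp del: mult_Suc_right)
    qed simp
    ultimately show "A \<in> (\<Union>b. ?f b ` topspace (?W b))" by blast
  qed
qed

lemma Hurewicz_if_first_power:
  assumes "Hurewicz_space (finite_power X 1)" "topspace X \<noteq> {}"
  shows "Hurewicz_space X"
proof (rule Hurewicz_countable_union_of_images[of "\<lambda>_. finite_power X 1" _ "\<lambda>_ p. p 0"])
  show "Hurewicz_space (finite_power X 1)" by (rule assms(1))
  show "topspace (finite_power X 1) \<noteq> {}" by (rule topspace_finite_power_nonempty[OF assms(2)])
  show "continuous_map (finite_power X 1) X (\<lambda>p. p 0)"
    unfolding finite_power_def by (rule continuous_map_product_projection) simp
  show "topspace X \<subseteq> (\<Union>n::nat. (\<lambda>p. p 0) ` topspace (finite_power X 1))"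
  proof
    fix x assume "x \<in> topspace X"
    then have "(\<lambda>i\<in>{..<1}. x) \<in> topspace (finite_power X 1)" by (auto simp: finite_power_def)
    moreover have "x = (\<lambda>i\<in>{..<1::nat}. x) 0" by simp
    ultimately show "x \<in> (\<Union>n::nat. (\<lambda>p. p 0) ` topspace (finite_power X 1))" by blast
  qed
qed

section \<open>Omega-covers\<close>

lemma omega_coversI:
  assumes "\<W> \<subseteq> proper_opens X" "\<And>F. F \<in> fin_subsets (topspace X) \<Longrightarrow> \<exists>W\<in>\<W>. F \<subseteq> W"
  shows "\<W> \<in> omega_covers X"
proof -
  have "topspace X \<subseteq> \<Union>\<W>"
  proof
    fix x assume "x \<in> topspace X"
    then have "{x} \<in> fin_subsets (topspace X)" by (simp add: fin_subsets_def)
    from assms(2)[OF this] show "x \<in> \<Union>\<W>" by blast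
  qed
  moreover have "\<Union>\<W> \<subseteq> topspace X"
    using assms(1) by (auto simp: proper_opens_def dest: openin_subset)
  ultimately show ?thesis using assms by (auto simp: omega_covers_def open_covers_def)
qed

lemma omega_coversD:
  assumes "\<W> \<in> omega_covers X"
  shows "\<And>W. W \<in> \<W> \<Longrightarrow> openin X W" "\<And>W. W \<in> \<W> \<Longrightarrow> W \<noteq> topspace X"
    "\<And>F. F \<in> fin_subsets (topspace X) \<Longrightarrow> \<exists>W\<in>\<W>. F \<subseteq> W"
  using assms by (auto simp: omega_covers_def open_covers_def proper_opens_def)

text \<open>Each deleted set misses a point. Adding these points to a given finite set forces the
  covering member to be a remaining one.\<close>

lemma omega_cover_diff_finite:
  assumes \<W>: "\<W> \<in> omega_covers X" and "finite \<D>"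
  shows "\<W> - \<D> \<in> omega_covers X"
proof (rule omega_coversI)
  show "\<W> - \<D> \<subseteq> proper_opens X"
    using \<W> by (auto simp: omega_covers_def open_covers_def)
  fix F assume F: "F \<in> fin_subsets (topspace X)"
  have "\<exists>x. x \<in> topspace X \<and> x \<notin> W" if "W \<in> \<W>" for W
    using omega_coversD(1,2)[OF \<W> that] openin_subset[of X W] by blast
  then obtain q where q: "\<And>W. W \<in> \<W> \<Longrightarrow> q W \<in> topspace X \<and> q W \<notin> W" by metis
  have "F \<union> q ` (\<W> \<inter> \<D>) \<in> fin_subsets (topspace X)"
    using F q \<open>finite \<D>\<close> by (auto simp: fin_subsets_def)
  then obtain W where W: "W \<in> \<W>" "F \<union> q ` (\<W> \<inter> \<D>) \<subseteq> W" using omega_coversD(3)[OF \<W>] by metis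
  then have "W \<notin> \<D>" using q by blast
  with W show "\<exists>W\<in>\<W> - \<D>. F \<subseteq> W" by blast
qed

lemma common_refinement_omega_cover:
  assumes \<V>: "\<And>i. i \<le> m \<Longrightarrow> \<V> i \<in> omega_covers X"
  shows "{V \<in> proper_opens X. \<forall>i\<le>m::nat. \<exists>U\<in>\<V> i. V \<subseteq> U} \<in> omega_covers X"
proof (rule omega_coversI)
  fix F assume F: "F \<in> fin_subsets (topspace X)"
  have "\<forall>i\<in>{..m}. \<exists>U. U \<in> \<V> i \<and> F \<subseteq> U" using omega_coversD(3)[OF \<V> F] by auto
  then obtain U where U: "\<And>i. i \<le> m \<Longrightarrow> U i \<in> \<V> i \<and> F \<subseteq> U i" by (metis atMost_iff)
  let ?V = "\<Inter>i\<in>{..m}. U i"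
  have "openin X (U i)" if "i \<le> m" for i
    using omega_coversD(1)[OF \<V>[OF that]] U[OF that] by blast
  then have "openin X ?V" by (intro openin_Inter) auto
  moreover have FV: "F \<subseteq> ?V" using U by auto
  moreover have "?V \<noteq> {}" using FV F by (auto simp: fin_subsets_def)
  moreover have "?V \<noteq> topspace X"
  proof
    assume "?V = topspace X"
    then have "topspace X \<subseteq> U 0" by auto
    then show False
      using U[of 0] omega_coversD(1,2)[OF \<V>[of 0], of "U 0"] openin_subset[of X "U 0"] by auto
  qed
  ultimately show "\<exists>W\<in>{V \<in> proper_opens X. \<forall>i\<le>m. \<exists>U\<in>\<V> i. V \<subseteq> U}. F \<subseteq> W"
    using U by (intro bexI[of _ ?V]) (auto simp: proper_opens_def)
qed blast

section \<open>Eventual selections from omega-covers\<close>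

text \<open>This is the Hurewicz property of the space of finite sets, restricted to covers by the sets
  of all finite subsets of a given open set. Both the selection principle for omega-covers and
  the one for function spaces yield it, and for infinite T1 spaces it suffices for the Hurewicz
  property of the finite powers.\<close>

definition eventual_omega_selections :: "'a topology \<Rightarrow> bool" where
  "eventual_omega_selections X \<longleftrightarrow>
     (\<forall>\<V> :: nat \<Rightarrow> 'a set set. (\<forall>m. \<V> m \<in> omega_covers X) \<longrightarrow>
        (\<exists>H. (\<forall>m. finite (H m) \<and> H m \<subseteq> \<V> m) \<and>
          (\<forall>F\<in>fin_subsets (topspace X). \<exists>m. \<forall>k\<ge>m. \<exists>V\<in>H k. F \<subseteq> V)))"

text \<open>Replacing the covers by common refinements of initial segments makes them decreasing, so
  that the groups of the selection can be matched with the stages.\<close>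

lemma eventual_omega_selections_if_S_fin:
  assumes S: "S_fin (omega_covers X) (gp (omega_covers X))"
  shows "eventual_omega_selections X"
  unfolding eventual_omega_selections_def
proof (intro allI impI)
  fix \<V> :: "nat \<Rightarrow> 'a set set" assume \<V>: "\<forall>m. \<V> m \<in> omega_covers X"
  let ?W = "\<lambda>m. {V \<in> proper_opens X. \<forall>i\<le>m. \<exists>U\<in>\<V> i. V \<subseteq> U}"
  obtain G where G: "\<And>m. finite (G m)" "\<And>m. G m \<subseteq> ?W m"
    "\<And>J. infinite J \<Longrightarrow> (\<Union>m\<in>J. G m) \<in> omega_covers X"
  proof (rule S_fin_gp_decreasing[OF S, of ?W])
    show "?W m \<in> omega_covers X" for m by (rule common_refinement_omega_cover) (use \<V> in blast)
    show "?W n \<subseteq> ?W m" if "m \<le> n" for m n using that order_trans by blast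
  qed blast
  have ex: "\<exists>U. U \<in> \<V> m \<and> V \<subseteq> U" if "V \<in> G m" for m V using G(2)[of m] that by blast
  define u where "u m V = (SOME U. U \<in> \<V> m \<and> V \<subseteq> U)" for m V
  have u: "u m V \<in> \<V> m \<and> V \<subseteq> u m V" if "V \<in> G m" for m V
    unfolding u_def by (rule someI_ex) (rule ex[OF that])
  have "\<exists>m. \<forall>k\<ge>m. \<exists>V\<in>u k ` G k. F \<subseteq> V" if F: "F \<in> fin_subsets (topspace X)" for F
  proof (rule cofinite_if_every_infinite_set_meets)
    fix J :: "nat set" assume "infinite J"
    then obtain n V where "n \<in> J" "V \<in> G n" "F \<subseteq> V"
      using omega_coversD(3)[OF G(3) F] by blast
    then show "\<exists>n\<in>J. \<exists>V\<in>u n ` G n. F \<subseteq> V" using u by blast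
  qed
  moreover have "finite (u m ` G m) \<and> u m ` G m \<subseteq> \<V> m" for m using G(1) u by blast
  ultimately show "\<exists>H. (\<forall>m. finite (H m) \<and> H m \<subseteq> \<V> m) \<and>
          (\<forall>F\<in>fin_subsets (topspace X). \<exists>m. \<forall>k\<ge>m. \<exists>V\<in>H k. F \<subseteq> V)"
    by (intro exI[of _ "\<lambda>m. u m ` G m"]) blast
qed

text \<open>The tube lemma for finite sets: only the finitely many tuples from \<open>F\<close> need to be
  covered by boxes, and the neighbourhood of a point is the intersection of all sides that occur
  over it in these boxes.\<close>

lemma finite_set_cube_finitely_covered:
  assumes op: "\<And>U. U \<in> \<U> \<Longrightarrow> openin (finite_power X n) U"
    and cov: "topspace (finite_power X n) \<subseteq> \<Union>\<U>"
    and F: "finite F" "F \<subseteq> topspace X"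
  obtains V \<D> where "openin X V" "F \<subseteq> V" "finite \<D>" "\<D> \<subseteq> \<U>" "(\<Pi>\<^sub>E i\<in>{..<n}. V) \<subseteq> \<Union>\<D>"
proof -
  define P where "P = (\<Pi>\<^sub>E i\<in>{..<n}. F)"
  have "finite P" unfolding P_def using F(1) by (intro finite_PiE) auto
  have "\<exists>U B. U \<in> \<U> \<and> (\<forall>i<n. openin X (B i) \<and> p i \<in> B i) \<and> Pi\<^sub>E {..<n} B \<subseteq> U" if "p \<in> P" for p
  proof -
    have "p \<in> topspace (finite_power X n)"
      using that F(2) by (auto simp: P_def finite_power_def PiE_iff)
    then obtain U where U: "U \<in> \<U>" "p \<in> U" using cov by blast
    have "\<forall>x\<in>U. \<exists>B. finite {i \<in> {..<n}. B i \<noteq> topspace X} \<and>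
        (\<forall>i\<in>{..<n}. openin X (B i)) \<and> x \<in> Pi\<^sub>E {..<n} B \<and> Pi\<^sub>E {..<n} B \<subseteq> U"
      using op[OF U(1)] unfolding finite_power_def openin_product_topology_alt .
    then obtain B where "\<forall>i\<in>{..<n}. openin X (B i)" "p \<in> Pi\<^sub>E {..<n} B" "Pi\<^sub>E {..<n} B \<subseteq> U"
      using U(2) by blast
    then show ?thesis using U(1) by (intro exI[of _ U] exI[of _ B]) (auto simp: PiE_iff)
  qed
  then obtain u B where uB: "\<And>p. p \<in> P \<Longrightarrow> u p \<in> \<U>"
    "\<And>p i. p \<in> P \<Longrightarrow> i < n \<Longrightarrow> openin X (B p i) \<and> p i \<in> B p i"
    "\<And>p. p \<in> P \<Longrightarrow> Pi\<^sub>E {..<n} (B p) \<subseteq> u p"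
    by metis
  define N where "N x = \<Inter>(insert (topspace X) {B p i |p i. p \<in> P \<and> i < n \<and> p i = x})" for x
  have oN: "openin X (N x)" for x
    unfolding N_def
  proof (rule openin_Inter)
    have "{B p i |p i. p \<in> P \<and> i < n \<and> p i = x} \<subseteq> (\<lambda>(p, i). B p i) ` (P \<times> {..<n})" by auto
    then show "finite (insert (topspace X) {B p i |p i. p \<in> P \<and> i < n \<and> p i = x})"
      using \<open>finite P\<close> by (simp add: finite_subset)
  qed (use uB(2) in auto)
  have xN: "x \<in> N x" if "x \<in> F" for x
    unfolding N_def using that F(2) uB(2) by auto
  show thesis
  proof (rule that)
    show "openin X (\<Union>x\<in>F. N x)" by (rule openin_Union) (use oN in blast)
    show "F \<subseteq> (\<Union>x\<in>F. N x)" using xN by blast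
    show "finite (u ` P)" "u ` P \<subseteq> \<U>" using \<open>finite P\<close> uB(1) by auto
    show "(\<Pi>\<^sub>E i\<in>{..<n}. (\<Union>x\<in>F. N x)) \<subseteq> \<Union>(u ` P)"
    proof
      fix v assume v: "v \<in> (\<Pi>\<^sub>E i\<in>{..<n}. (\<Union>x\<in>F. N x))"
      then have "\<forall>i\<in>{..<n}. \<exists>x. x \<in> F \<and> v i \<in> N x" by (auto simp: PiE_iff)
      then obtain y where y: "\<And>i. i < n \<Longrightarrow> y i \<in> F \<and> v i \<in> N (y i)" by (metis lessThan_iff)
      define p where "p = restrict y {..<n}"
      have p: "p \<in> P" using y by (auto simp: p_def P_def)
      have "v i \<in> B p i" if "i < n" for i
      proof -
        have "v i \<in> N (p i)" using y[OF that] that by (simp add: p_def)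
        then show ?thesis using p that unfolding N_def by blast
      qed
      then have "v \<in> Pi\<^sub>E {..<n} (B p)" using v by (auto simp: PiE_iff)
      then show "v \<in> \<Union>(u ` P)" using uB(3)[OF p] p by blast
    qed
  qed
qed

text \<open>For an open cover of the power, the open sets whose cube is finitely covered form an
  omega-cover. As \<open>X\<close> is infinite, a point outside a given finite set can be deleted from such an
  open set, which keeps it different from \<open>X\<close>.\<close>

lemma Hurewicz_power_if_eventual_omega_selections:
  assumes E: "eventual_omega_selections X" and X: "t1_space X" "infinite (topspace X)" and n: "n \<ge> 1"
  shows "Hurewicz_space (finite_power X n)"
  unfolding Hurewicz_space_def
proof (intro allI impI)
  let ?P = "finite_power X n"
  fix \<U> assume \<U>: "\<forall>m::nat. \<U> m \<in> open_covers ?P"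
  have op: "openin ?P U" if "U \<in> \<U> m" for U m
    using \<U> that by (auto simp: open_covers_def proper_opens_def)
  have cov: "topspace ?P = \<Union>(\<U> m)" for m using \<U> by (simp add: open_covers_def)
  define \<V> where "\<V> m = {V \<in> proper_opens X. \<exists>\<D>. finite \<D> \<and> \<D> \<subseteq> \<U> m \<and> (\<Pi>\<^sub>E i\<in>{..<n}. V) \<subseteq> \<Union>\<D>}" for m
  have "\<V> m \<in> omega_covers X" for m
  proof (rule omega_coversI)
    fix F assume "F \<in> fin_subsets (topspace X)"
    then have F: "finite F" "F \<subseteq> topspace X" "F \<noteq> {}" by (auto simp: fin_subsets_def)
    obtain V \<D> where V: "openin X V" "F \<subseteq> V" "finite \<D>" "\<D> \<subseteq> \<U> m" "(\<Pi>\<^sub>E i\<in>{..<n}. V) \<subseteq> \<Union>\<D>"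
      by (rule finite_set_cube_finitely_covered[of "\<U> m" X n F]) (use op cov F in auto)
    obtain y where y: "y \<in> topspace X" "y \<notin> F" using X(2) F(1,2) by (metis finite_subset subsetI)
    have "openin X (V - {y})" by (rule openin_T1_diff_finite[OF X(1) V(1)]) simp
    moreover have sub: "F \<subseteq> V - {y}" using V(2) y(2) by blast
    moreover have "V - {y} \<noteq> {}" "V - {y} \<noteq> topspace X" using sub F(3) y(1) by blast+
    moreover have "(\<Pi>\<^sub>E i\<in>{..<n}. V - {y}) \<subseteq> (\<Pi>\<^sub>E i\<in>{..<n}. V)" by (intro PiE_mono) blast
    with V(5) have "(\<Pi>\<^sub>E i\<in>{..<n}. V - {y}) \<subseteq> \<Union>\<D>" by (rule order_trans[rotated])
    ultimately have "V - {y} \<in> \<V> m" using V(3,4) unfolding \<V>_def proper_opens_def by blast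
    with sub show "\<exists>W\<in>\<V> m. F \<subseteq> W" by blast
  qed (auto simp: \<V>_def)
  from E[unfolded eventual_omega_selections_def, rule_format, of \<V>, OF this]
  obtain H where H: "\<forall>m. finite (H m) \<and> H m \<subseteq> \<V> m"
    and ev: "\<forall>F\<in>fin_subsets (topspace X). \<exists>m. \<forall>k\<ge>m. \<exists>V\<in>H k. F \<subseteq> V"
    by (elim exE conjE)
  have ex: "\<exists>\<D>. finite \<D> \<and> \<D> \<subseteq> \<U> m \<and> (\<Pi>\<^sub>E i\<in>{..<n}. V) \<subseteq> \<Union>\<D>" if "V \<in> H m" for m V
    using H that by (auto simp: \<V>_def)
  define D where "D m V = (SOME \<D>. finite \<D> \<and> \<D> \<subseteq> \<U> m \<and> (\<Pi>\<^sub>E i\<in>{..<n}. V) \<subseteq> \<Union>\<D>)" for m V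
  have D: "finite (D m V) \<and> D m V \<subseteq> \<U> m \<and> (\<Pi>\<^sub>E i\<in>{..<n}. V) \<subseteq> \<Union>(D m V)" if "V \<in> H m" for m V
    unfolding D_def by (rule someI_ex) (rule ex[OF that])
  have "topspace X \<noteq> {}" using X(2) by auto
  then have "\<U> m \<noteq> {}" for m using topspace_finite_power_nonempty[of X n] cov[of m] by auto
  then have "\<forall>m. \<exists>U. U \<in> \<U> m" by blast
  then obtain a where a: "\<And>m. a m \<in> \<U> m" by metis
  let ?F = "\<lambda>m. insert (a m) (\<Union>V\<in>H m. D m V)"
  have "\<exists>m. \<forall>k\<ge>m. z \<in> \<Union>(?F k)" if z: "z \<in> topspace ?P" for z
  proof -
    have "z ` {..<n} \<in> fin_subsets (topspace X)"
      unfolding fin_subsets_def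
    proof (intro CollectI conjI)
      show "z ` {..<n} \<subseteq> topspace X" using z by (auto simp: finite_power_def PiE_iff)
      show "z ` {..<n} \<noteq> {}" using n by (simp add: lessThan_empty_iff)
    qed simp
    from bspec[OF ev this] obtain m where m: "\<forall>k\<ge>m. \<exists>V\<in>H k. z ` {..<n} \<subseteq> V" by (rule exE)
    have "z \<in> \<Union>(?F k)" if "k \<ge> m" for k
    proof -
      from m that have "\<exists>V\<in>H k. z ` {..<n} \<subseteq> V" by simp
      then obtain V where V: "V \<in> H k" "z ` {..<n} \<subseteq> V" by (rule bexE)
      have "z i \<in> V" if "i < n" for i using V(2) that by (simp add: image_subset_iff)
      then have "z \<in> (\<Pi>\<^sub>E i\<in>{..<n}. V)" using z by (simp add: finite_power_def PiE_iff)
      then have "z \<in> \<Union>(D k V)" using D[OF V(1)] by (elim conjE) (rule subsetD)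
      then show ?thesis using V(1) by blast
    qed
    then show ?thesis by blast
  qed
  moreover have "?F m \<in> fin_subsets (\<U> m)" for m
    using a D H by (simp add: fin_subsets_def UN_subset_iff)
  ultimately show "\<exists>\<F>. (\<forall>m. \<F> m \<in> fin_subsets (\<U> m)) \<and>
        (\<forall>z\<in>topspace ?P. \<exists>m. \<forall>k\<ge>m. z \<in> \<Union>(\<F> k))"
    by (intro exI[of _ ?F]) blast
qed

section \<open>The game on omega-covers\<close>

text \<open>A play that catches every finite set at almost all innings, and whose moves are disjoint, has
  its moves as groups: any infinitely many of them form an omega-cover.\<close>

lemma One_has_no_winning_strategy_omega:
  assumes H: "Hurewicz_space (Pfin X)" and ne: "topspace X \<noteq> {}"
  shows "\<not> G_fin_winning_One (omega_covers X) (gp (omega_covers X)) \<sigma>"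
proof
  assume win: "G_fin_winning_One (omega_covers X) (gp (omega_covers X)) \<sigma>"
  define M where "M = (\<Union>A\<in>omega_covers X. fin_subsets A)"
  have \<sigma>: "\<sigma> s \<in> omega_covers X" if "s \<in> lists M" for s
    using win that unfolding G_fin_winning_One_def G_fin_strategy_One_def M_def by blast
  let ?N = "\<lambda>U. {F \<in> fin_subsets (topspace X). F \<subseteq> U}"
  obtain F :: "nat \<Rightarrow> 'a set set"
    where F: "\<And>n. F n \<in> fin_subsets (\<sigma> (map F [0..<n]))" "\<And>n. map F [0..<n] \<in> lists M"
      "disjoint_family F"
      and ev: "\<And>E. E \<in> topspace (Pfin X) \<Longrightarrow> \<exists>m. \<forall>n\<ge>m. \<exists>U\<in>F n. E \<in> ?N U"
  proof (rule Hurewicz_game_disjoint[OF H topspace_Pfin_nonempty[OF ne], of M \<sigma> "\<lambda>_. ?N"])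
    show "finite D" if "D \<in> M" for D using that by (auto simp: M_def fin_subsets_def)
    show "D \<in> M" if "s \<in> lists M" "D \<in> fin_subsets (\<sigma> s)" for s D
      using that \<sigma> unfolding M_def by blast
    show "openin (Pfin X) (?N U)" if "s \<in> lists M" "U \<in> \<sigma> s" for s U
      by (rule openin_Pfin_subset) (rule omega_coversD(1)[OF \<sigma>[OF that(1)] that(2)])
    show "topspace (Pfin X) \<subseteq> (\<Union>U\<in>\<sigma> s - D. ?N U)" if "s \<in> lists M" "finite D" for s D
    proof
      fix E assume "E \<in> topspace (Pfin X)"
      then have E: "E \<in> fin_subsets (topspace X)" by (simp add: topspace_Pfin)
      then show "E \<in> (\<Union>U\<in>\<sigma> s - D. ?N U)"
        using omega_coversD(3)[OF omega_cover_diff_finite[OF \<sigma>[OF that(1)] that(2)] E] by blast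
    qed
  qed blast
  have "(\<Union>n. F n) \<in> gp (omega_covers X)"
  proof (rule disjoint_union_groupable)
    show "finite (F n)" for n using F(1)[of n] by (simp add: fin_subsets_def)
    show "disjoint_family F" by fact
    fix J :: "nat set" assume J: "infinite J"
    show "(\<Union>n\<in>J. F n) \<in> omega_covers X"
    proof (rule omega_coversI)
      have "F n \<subseteq> proper_opens X" for n
        using F(1)[of n] \<sigma>[OF F(2)[of n]] by (auto simp: fin_subsets_def omega_covers_def open_covers_def)
      then show "(\<Union>n\<in>J. F n) \<subseteq> proper_opens X" by blast
      fix E assume "E \<in> fin_subsets (topspace X)"
      then obtain m where m: "\<forall>n\<ge>m. \<exists>U\<in>F n. E \<in> ?N U" using ev unfolding topspace_Pfin by blast
      obtain n where "n \<in> J" "m \<le> n" using J unfolding infinite_nat_iff_unbounded_le by blast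
      with m show "\<exists>W\<in>\<Union>n\<in>J. F n. E \<subseteq> W" by blast
    qed
  qed
  then show False using win F(1) unfolding G_fin_winning_One_def by blast
qed

text \<open>A sequence without a selection is a winning strategy that ignores the moves of Two.\<close>

lemma S_fin_if_One_has_no_winning_strategy:
  assumes "\<nexists>\<sigma>. G_fin_winning_One \<A> \<B> \<sigma>"
  shows "S_fin \<A> \<B>"
  unfolding S_fin_def
proof (intro allI impI, rule ccontr)
  fix A :: "nat \<Rightarrow> 'a set" assume A: "\<forall>n. A n \<in> \<A>"
    and no: "\<nexists>F. (\<forall>n. F n \<in> fin_subsets (A n)) \<and> (\<Union>n. F n) \<in> \<B>"
  have "G_fin_winning_One \<A> \<B> (\<lambda>s. A (length s))"
    unfolding G_fin_winning_One_def G_fin_strategy_One_def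
  proof (intro conjI ballI allI impI)
    show "(\<Union>n. F n) \<notin> \<B>" if "\<forall>n. F n \<in> fin_subsets (A (length (map F [0..<n])))" for F
      using no that by auto
  qed (use A in blast)
  with assms show False by blast
qed

section \<open>Function spaces\<close>

lemma closure_of_Cp_iff:
  assumes z: "z \<in> topspace (Cp X)" and A: "A \<subseteq> topspace (Cp X)" and ne: "topspace X \<noteq> {}"
  shows "z \<in> Cp X closure_of A \<longleftrightarrow>
    (\<forall>F\<in>fin_subsets (topspace X). \<forall>e>0. \<exists>f\<in>A. \<forall>x\<in>F. \<bar>f x - z x\<bar> < e)" (is "?L \<longleftrightarrow> ?R")
proof
  assume L: ?L
  show ?R
  proof (intro ballI allI impI)
    fix F and e :: real assume F: "F \<in> fin_subsets (topspace X)" and e: "0 < e"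
    let ?T = "\<Pi>\<^sub>E x\<in>topspace X. if x \<in> F then {t. \<bar>t - z x\<bar> < e} else UNIV"
    have "open {t. \<bar>t - z x\<bar> < e}" for x
    proof -
      have "{t. \<bar>t - z x\<bar> < e} = ball (z x) e" by (auto simp: dist_real_def abs_minus_commute)
      then show ?thesis by simp
    qed
    moreover have "finite {x \<in> topspace X. (if x \<in> F then {t. \<bar>t - z x\<bar> < e} else UNIV) \<noteq> UNIV}"
      by (rule finite_subset[of _ F]) (use F in \<open>auto simp: fin_subsets_def\<close>)
    ultimately have "openin (product_topology (\<lambda>_. euclideanreal) (topspace X)) ?T"
      by (simp add: openin_PiE_gen)
    then have "openin (Cp X) (?T \<inter> {f. continuous_map X euclideanreal f})"
      unfolding Cp_def by (rule openin_subtopology_Int)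
    moreover have "z \<in> ?T \<inter> {f. continuous_map X euclideanreal f}"
      using z e by (auto simp: topspace_Cp PiE_iff)
    ultimately have "\<exists>f. f \<in> A \<and> f \<in> ?T \<inter> {f. continuous_map X euclideanreal f}"
      using L[unfolded in_closure_of] by (elim conjE allE impE) (rule conjI)
    then obtain f where "f \<in> A" and fT: "f \<in> ?T" by (elim exE conjE IntE)
    have "\<bar>f x - z x\<bar> < e" if "x \<in> F" for x
    proof -
      have "x \<in> topspace X" using that F by (auto simp: fin_subsets_def)
      then have "f x \<in> (if x \<in> F then {t. \<bar>t - z x\<bar> < e} else UNIV)"
        by (rule PiE_mem[OF fT])
      then show ?thesis using that by simp
    qed
    with \<open>f \<in> A\<close> show "\<exists>f\<in>A. \<forall>x\<in>F. \<bar>f x - z x\<bar> < e" by blast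
  qed
next
  assume R: ?R
  show ?L
    unfolding in_closure_of
  proof (intro conjI allI impI)
    show "z \<in> topspace (Cp X)" by (rule z)
    fix T assume T: "z \<in> T \<and> openin (Cp X) T"
    then have "openin (Cp X) T" ..
    then obtain T' where T': "openin (product_topology (\<lambda>_. euclideanreal) (topspace X)) T'"
      "T = T' \<inter> {f. continuous_map X euclideanreal f}"
      unfolding Cp_def openin_subtopology by (elim exE conjE)
    have "z \<in> T'" using T T'(2) by blast
    from T'(1)[unfolded openin_product_topology_alt, rule_format, OF this]
    obtain U where U: "finite {x \<in> topspace X. U x \<noteq> UNIV}"
      "\<And>x. x \<in> topspace X \<Longrightarrow> open (U x)" "z \<in> Pi\<^sub>E (topspace X) U" "Pi\<^sub>E (topspace X) U \<subseteq> T'"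
      by auto
    let ?F = "{x \<in> topspace X. U x \<noteq> UNIV}"
    have "\<exists>e>0. \<forall>t. \<bar>t - z x\<bar> < e \<longrightarrow> t \<in> U x" if "x \<in> topspace X" for x
    proof -
      have "z x \<in> U x" using U(3) that by (rule PiE_mem)
      then show ?thesis using U(2)[OF that] unfolding open_dist dist_real_def by blast
    qed
    then obtain e where e: "\<And>x. x \<in> topspace X \<Longrightarrow> e x > 0"
      "\<And>x t. x \<in> topspace X \<Longrightarrow> \<bar>t - z x\<bar> < e x \<Longrightarrow> t \<in> U x" by metis
    \<comment> \<open>The point \<open>a\<close> makes the finite set nonempty when \<open>U\<close> restricts no coordinate.\<close>
    obtain a where a: "a \<in> topspace X" using ne by blast
    define d where "d = Min (e ` insert a ?F)"
    have "d > 0" unfolding d_def using U(1) e(1) a by (subst Min_gr_iff) auto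
    have "insert a ?F \<in> fin_subsets (topspace X)" using U(1) a by (auto simp: fin_subsets_def)
    with R \<open>d > 0\<close> obtain f where f: "f \<in> A" "\<forall>x\<in>insert a ?F. \<bar>f x - z x\<bar> < d" by blast
    have fC: "f \<in> extensional (topspace X)" "continuous_map X euclideanreal f"
      using f(1) A by (auto simp: topspace_Cp)
    have "f x \<in> U x" if x: "x \<in> topspace X" for x
    proof (cases "U x = UNIV")
      case False
      then have xF: "x \<in> insert a ?F" using x by blast
      then have "\<bar>f x - z x\<bar> < d" using f(2) by blast
      also have "d \<le> e x" unfolding d_def using xF U(1) by (intro Min_le) auto
      finally show ?thesis by (rule e(2)[OF x])
    qed simp
    then have "f \<in> Pi\<^sub>E (topspace X) U" using fC(1) by (simp add: PiE_iff)
    then have "f \<in> T" using U(4) T'(2) fC(2) by blast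
    with f(1) show "\<exists>y. y \<in> A \<and> y \<in> T" by blast
  qed
qed

lemma t1_space_Cp: "t1_space (Cp X)"
  unfolding Cp_def
  by (intro Hausdorff_imp_t1_space Hausdorff_space_subtopology)
    (simp add: Hausdorff_space_product_topology)

lemma Omega_pt_diff_finite:
  assumes "t1_space Z" "A \<in> Omega_pt Z z" "finite D"
  shows "A - D \<in> Omega_pt Z z"
proof -
  have A: "A \<subseteq> topspace Z" "z \<in> Z closure_of A" "z \<notin> A" using assms(2) by (auto simp: Omega_pt_def)
  have "closedin Z (A \<inter> D)"
    using t1_space_closedin_finite[of Z] assms(1,3) A(1) by blast
  then have "Z closure_of (A \<inter> D) = A \<inter> D" by (rule closure_of_closedin)
  moreover have "Z closure_of A = Z closure_of (A - D) \<union> Z closure_of (A \<inter> D)"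
    by (metis Un_Diff_Int closure_of_Un)
  ultimately have "z \<in> Z closure_of (A - D)" using A by blast
  then show ?thesis using A by (auto simp: Omega_pt_def)
qed

lemma infinite_Omega_pt: "t1_space Z \<Longrightarrow> A \<in> Omega_pt Z z \<Longrightarrow> infinite A"
  using Omega_pt_diff_finite[of Z A z A] by (auto simp: Omega_pt_def)

text \<open>At stage \<open>n\<close> a function \<open>f\<close> stands for the set of all points where it is within
  \<open>1 / (n + 1)\<close> of \<open>z\<close>. Members of a family clustering at \<open>z\<close> thus cover the space of finite sets,
  and as the tolerance shrinks, any infinitely many stages of a winning play cluster at \<open>z\<close>.\<close>

lemma S_fin_Omega_pt_Cp:
  assumes H: "Hurewicz_space (Pfin X)" and ne: "topspace X \<noteq> {}" and z: "z \<in> topspace (Cp X)"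
  shows "S_fin (Omega_pt (Cp X) z) (gp (Omega_pt (Cp X) z))"
  unfolding S_fin_def
proof (intro allI impI)
  fix A :: "nat \<Rightarrow> ('a \<Rightarrow> real) set" assume A: "\<forall>n. A n \<in> Omega_pt (Cp X) z"
  then have AC: "A n \<subseteq> topspace (Cp X)" and zA: "z \<notin> A n" for n by (auto simp: Omega_pt_def)
  have cont: "continuous_map X euclideanreal z" using z by (simp add: topspace_Cp)
  let ?U = "\<lambda>e f. {x \<in> topspace X. f x - z x \<in> {t. \<bar>t\<bar> < e}}"
  have opU: "openin X (?U e f)" if "f \<in> topspace (Cp X)" for e f
  proof (rule openin_continuous_map_preimage)
    show "continuous_map X euclideanreal (\<lambda>x. f x - z x)"
      using that cont by (intro continuous_map_diff) (auto simp: topspace_Cp)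
    have "{t :: real. \<bar>t\<bar> < e} = ball 0 e" by auto
    then show "openin euclideanreal {t. \<bar>t\<bar> < e}" by simp
  qed
  let ?N = "\<lambda>s f. {F \<in> fin_subsets (topspace X). F \<subseteq> ?U (inverse (real (Suc (length s)))) f}"
  obtain F :: "nat \<Rightarrow> ('a \<Rightarrow> real) set"
    where F: "\<And>n. F n \<in> fin_subsets (A (length (map F [0..<n])))"
      "\<And>n. map F [0..<n] \<in> lists {D. finite D}" "disjoint_family F"
      and ev: "\<And>E. E \<in> topspace (Pfin X) \<Longrightarrow> \<exists>m. \<forall>n\<ge>m. \<exists>f\<in>F n. E \<in> ?N (map F [0..<n]) f"
  proof (rule Hurewicz_game_disjoint[OF H topspace_Pfin_nonempty[OF ne],
        of "{D. finite D}" "\<lambda>s. A (length s)" ?N])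
    show "D \<in> {D. finite D}" if "D \<in> fin_subsets (A (length s))" for D and s :: "('a \<Rightarrow> real) set list"
      using that by (simp add: fin_subsets_def)
    show "openin (Pfin X) (?N s f)" if "f \<in> A (length s)" for s :: "('a \<Rightarrow> real) set list" and f
      by (intro openin_Pfin_subset opU) (use that AC in blast)
    show "topspace (Pfin X) \<subseteq> (\<Union>f\<in>A (length s) - D. ?N s f)" if "finite D"
      for D and s :: "('a \<Rightarrow> real) set list"
    proof
      fix E assume "E \<in> topspace (Pfin X)"
      then have E: "E \<in> fin_subsets (topspace X)" by (simp add: topspace_Pfin)
      have "A (length s) - D \<in> Omega_pt (Cp X) z"
        using A that by (intro Omega_pt_diff_finite t1_space_Cp) blast
      then have "z \<in> Cp X closure_of (A (length s) - D)" "A (length s) - D \<subseteq> topspace (Cp X)"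
        by (auto simp: Omega_pt_def)
      moreover have "inverse (real (Suc (length s))) > 0" by simp
      ultimately obtain f where f: "f \<in> A (length s) - D"
        "\<forall>x\<in>E. \<bar>f x - z x\<bar> < inverse (real (Suc (length s)))"
        using closure_of_Cp_iff[OF z _ ne] E by blast
      have "E \<in> ?N s f" using f(2) E by (auto simp: fin_subsets_def)
      with f(1) show "E \<in> (\<Union>f\<in>A (length s) - D. ?N s f)" by blast
    qed
  qed (simp, blast)
  have FA: "F n \<in> fin_subsets (A n)" for n using F(1)[of n] by simp
  have "(\<Union>n. F n) \<in> gp (Omega_pt (Cp X) z)"
  proof (rule disjoint_union_groupable)
    show "finite (F n)" for n using FA[of n] by (simp add: fin_subsets_def)
    show "disjoint_family F" by fact
    fix J :: "nat set" assume J: "infinite J"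
    have sub: "F n \<subseteq> A n" for n using FA[of n] by (simp add: fin_subsets_def)
    have subC: "(\<Union>n\<in>J. F n) \<subseteq> topspace (Cp X)" using sub AC by blast
    have "z \<in> Cp X closure_of (\<Union>n\<in>J. F n)"
      unfolding closure_of_Cp_iff[OF z subC ne]
    proof (intro ballI allI impI)
      fix E and e :: real assume E: "E \<in> fin_subsets (topspace X)" and "0 < e"
      then obtain m where m: "\<forall>n\<ge>m. \<exists>f\<in>F n. E \<in> ?N (map F [0..<n]) f"
        using ev unfolding topspace_Pfin by blast
      obtain k where k: "inverse (real (Suc k)) < e" using reals_Archimedean[OF \<open>0 < e\<close>] by blast
      obtain n where n: "n \<in> J" "max m k \<le> n" using J unfolding infinite_nat_iff_unbounded_le by blast
      then have "m \<le> n" by simp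
      with m obtain f where f: "f \<in> F n" "E \<in> ?N (map F [0..<n]) f" by blast
      have "inverse (real (Suc n)) \<le> inverse (real (Suc k))"
        using n(2) by (intro le_imp_inverse_le) auto
      then have le: "inverse (real (Suc n)) < e" using k by linarith
      have "\<bar>f x - z x\<bar> < e" if "x \<in> E" for x
      proof -
        have "x \<in> ?U (inverse (real (Suc n))) f" using f(2) that by auto
        then show ?thesis using le by simp
      qed
      with f(1) n(1) show "\<exists>f\<in>\<Union>n\<in>J. F n. \<forall>x\<in>E. \<bar>f x - z x\<bar> < e" by blast
    qed
    moreover have "z \<notin> (\<Union>n\<in>J. F n)" using sub zA by blast
    ultimately show "(\<Union>n\<in>J. F n) \<in> Omega_pt (Cp X) z" using subC by (simp add: Omega_pt_def)
  qed
  with FA show "\<exists>F. (\<forall>n. F n \<in> fin_subsets (A n)) \<and> (\<Union>n. F n) \<in> gp (Omega_pt (Cp X) z)" by blast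
qed

lemma Omega_pt_superset:
  assumes "B \<in> Omega_pt Z z" "B \<subseteq> C" "C \<subseteq> topspace Z" "z \<notin> C"
  shows "C \<in> Omega_pt Z z"
  using assms closure_of_mono[OF assms(2), of Z] by (auto simp: Omega_pt_def)

text \<open>The selection principle for a constant sequence finds a groupable part of a countable family.
  The remaining members are distributed over the groups, at most one to each, which keeps the
  groups finite and can only enlarge the closures. Conversely, a groupable family is a
  countable union of finite groups, and a T1 space has no finite set that clusters at a point
  outside it.\<close>

lemma Reznichenko_space_if_S_fin:
  assumes Z: "t1_space Z"
    and S: "\<And>z. z \<in> topspace Z \<Longrightarrow> S_fin (Omega_pt Z z) (gp (Omega_pt Z z))"
  shows "Reznichenko_space Z"
  unfolding Reznichenko_space_def
proof (intro ballI equalityI subsetI)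
  fix z A assume z: "z \<in> topspace Z" and "A \<in> Omega_pt Z z \<inter> ctbl_subsets (topspace Z)"
  then have A: "A \<in> Omega_pt Z z" "countable A" by (auto simp: ctbl_subsets_def)
  have "\<exists>F. (\<forall>n. F n \<in> fin_subsets A) \<and> (\<Union>n::nat. F n) \<in> gp (Omega_pt Z z)"
    using S[OF z, unfolded S_fin_def, rule_format, of "\<lambda>_. A"] A(1) by blast
  then obtain F where F: "\<forall>n. F n \<in> fin_subsets A" "(\<Union>n::nat. F n) \<in> gp (Omega_pt Z z)" by (elim exE conjE)
  define B where "B = (\<Union>n. F n)"
  have B: "B \<subseteq> A" "B \<in> gp (Omega_pt Z z)"
    using F by (simp_all add: B_def fin_subsets_def UN_subset_iff)
  from gp_grouping[OF B(2)] obtain \<phi> :: "'a \<Rightarrow> nat" where fin: "\<forall>n. finite {c\<in>B. \<phi> c = n}"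
    and J: "\<forall>J. infinite J \<longrightarrow> (\<Union>n\<in>J. {c\<in>B. \<phi> c = n}) \<in> Omega_pt Z z"
    by (elim exE conjE)
  have cAB: "countable (A - B)" using A(2) by simp
  define \<psi> where "\<psi> c = (if c \<in> B then \<phi> c else to_nat_on (A - B) c)" for c
  have "finite {c\<in>A. \<psi> c = n}" for n
  proof -
    have "finite (to_nat_on (A - B) -` {n} \<inter> (A - B))"
      by (rule finite_vimage_IntI) (simp_all add: inj_on_to_nat_on[OF cAB])
    then have "finite ({c\<in>B. \<phi> c = n} \<union> (to_nat_on (A - B) -` {n} \<inter> (A - B)))" using fin by simp
    then show ?thesis by (rule finite_subset[rotated]) (auto simp: \<psi>_def split: if_splits)
  qed
  moreover have "(\<Union>n\<in>J. {c\<in>A. \<psi> c = n}) \<in> Omega_pt Z z" if "infinite J" for J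
  proof (rule Omega_pt_superset[OF J[rule_format, OF that]])
    show "(\<Union>n\<in>J. {c\<in>B. \<phi> c = n}) \<subseteq> (\<Union>n\<in>J. {c\<in>A. \<psi> c = n})"
      using B(1) by (auto simp: \<psi>_def)
  qed (use A(1) in \<open>auto simp: Omega_pt_def\<close>)
  ultimately have "groupable_in (Omega_pt Z z) A" unfolding groupable_in_def by blast
  then show "A \<in> gp (Omega_pt Z z)" using A(1) by (simp add: gp_def)
next
  fix z A assume gp: "A \<in> gp (Omega_pt Z z)"
  then have A: "A \<in> Omega_pt Z z" by (simp add: gp_def)
  from gp_grouping[OF gp] obtain \<phi> :: "'a \<Rightarrow> nat" where fin: "\<forall>n. finite {c\<in>A. \<phi> c = n}"
    by (elim exE conjE)
  have "A = (\<Union>n. {c\<in>A. \<phi> c = n})" by auto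
  moreover have "countable (\<Union>n. {c\<in>A. \<phi> c = n})" using fin by (simp add: countable_finite)
  ultimately have "countable A" by simp
  with A infinite_Omega_pt[OF Z A] show "A \<in> Omega_pt Z z \<inter> ctbl_subsets (topspace Z)"
    by (simp add: ctbl_subsets_def Omega_pt_def)
qed

text \<open>A union of finite selections is countable, hence groupable by the Reznichenko property.\<close>

lemma S_fin_if_Reznichenko_space:
  assumes R: "Reznichenko_space Z" and T: "countable_fan_tightness Z" and Z: "t1_space Z" "z \<in> topspace Z"
  shows "S_fin (Omega_pt Z z) (gp (Omega_pt Z z))"
  unfolding S_fin_def
proof (intro allI impI)
  fix A :: "nat \<Rightarrow> 'a set" assume A: "\<forall>n. A n \<in> Omega_pt Z z"
  have "S_fin (Omega_pt Z z) (Omega_pt Z z)" using T Z(2) by (simp add: countable_fan_tightness_def)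
  with A obtain F where F: "\<forall>n. F n \<in> fin_subsets (A n)" "(\<Union>n. F n) \<in> Omega_pt Z z"
    unfolding S_fin_def by blast
  have "countable (F n)" for n using F(1) by (simp add: fin_subsets_def countable_finite)
  then have "countable (\<Union>n. F n)" by simp
  with F(2) infinite_Omega_pt[OF Z(1) F(2)] have "(\<Union>n. F n) \<in> ctbl_subsets (topspace Z)"
    by (simp add: ctbl_subsets_def Omega_pt_def)
  with F(2) R Z(2) have "(\<Union>n. F n) \<in> gp (Omega_pt Z z)"
    unfolding Reznichenko_space_def by blast
  with F(1) show "\<exists>F. (\<forall>n. F n \<in> fin_subsets (A n)) \<and> (\<Union>n. F n) \<in> gp (Omega_pt Z z)" by blast
qed

text \<open>Complete regularity turns an omega-cover into a family clustering at zero: a finite set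
  inside a member \<open>V\<close> is separated from the complement of \<open>V\<close>. Zero itself stays outside, since
  every member misses a point.\<close>

lemma functions_one_off_omega_cover:
  assumes X: "completely_regular_space X" "Hausdorff_space X" and ne: "topspace X \<noteq> {}"
    and \<W>: "\<W> \<in> omega_covers X"
  shows "{f \<in> topspace (Cp X). \<exists>V\<in>\<W>. \<forall>x\<in>topspace X - V. f x = 1} \<in> Omega_pt (Cp X) (Cp_zero X)"
    (is "?A \<in> _")
proof -
  have "Cp_zero X \<notin> ?A"
  proof
    assume "Cp_zero X \<in> ?A"
    then obtain V where V: "V \<in> \<W>" "\<forall>x\<in>topspace X - V. Cp_zero X x = 1" by blast
    obtain x where "x \<in> topspace X - V"
      using omega_coversD(1,2)[OF \<W> V(1)] openin_subset[of X V] by blast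
    with V(2) show False by (auto simp: Cp_zero_def)
  qed
  moreover have sub: "?A \<subseteq> topspace (Cp X)" by blast
  moreover have "Cp_zero X \<in> Cp X closure_of ?A"
    unfolding closure_of_Cp_iff[OF Cp_zero_in_Cp sub ne]
  proof (intro ballI allI impI)
    fix F and e :: real assume F: "F \<in> fin_subsets (topspace X)" and "0 < e"
    obtain V where V: "V \<in> \<W>" "F \<subseteq> V" using omega_coversD(3)[OF \<W> F] by blast
    have "compactin X F" using F by (simp add: fin_subsets_def finite_imp_compactin)
    moreover have "closedin X (topspace X - V)" using omega_coversD(1)[OF \<W> V(1)] by blast
    moreover have "disjnt F (topspace X - V)" using V(2) by (auto simp: disjnt_def)
    ultimately obtain f where f: "continuous_map X euclideanreal f"
      "f ` (topspace X - V) \<subseteq> {1}" "f ` F \<subseteq> {0}"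
      using Urysohn_completely_regular_compact_closed_alt[OF X(1), of F "topspace X - V" 1 0] by blast
    let ?f = "restrict f (topspace X)"
    have "continuous_map X euclideanreal ?f" using f(1) by (rule continuous_map_eq) simp
    then have "?f \<in> topspace (Cp X)" by (simp add: topspace_Cp)
    moreover have "?f x = 1" if "x \<in> topspace X - V" for x using f(2) that by auto
    ultimately have "?f \<in> ?A" using V(1) by blast
    moreover have "\<bar>?f x - Cp_zero X x\<bar> < e" if "x \<in> F" for x
    proof -
      have "x \<in> topspace X" "f x = 0" using that F f(3) by (auto simp: fin_subsets_def)
      then show ?thesis using \<open>0 < e\<close> by (simp add: Cp_zero_def)
    qed
    ultimately show "\<exists>f\<in>?A. \<forall>x\<in>F. \<bar>f x - Cp_zero X x\<bar> < e" by blast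
  qed
  ultimately show ?thesis by (simp add: Omega_pt_def)
qed

text \<open>Where a function that is one off \<open>V\<close> is closer than one to zero, the point lies in \<open>V\<close>.
  Selections near zero are thereby translated back to selections from the covers.\<close>

lemma eventual_omega_selections_if_S_fin_Cp:
  assumes X: "completely_regular_space X" "Hausdorff_space X" and ne: "topspace X \<noteq> {}"
    and S: "S_fin (Omega_pt (Cp X) (Cp_zero X)) (gp (Omega_pt (Cp X) (Cp_zero X)))"
  shows "eventual_omega_selections X"
  unfolding eventual_omega_selections_def
proof (intro allI impI)
  fix \<V> :: "nat \<Rightarrow> 'a set set" assume \<V>: "\<forall>m. \<V> m \<in> omega_covers X"
  define W where "W m = {V \<in> proper_opens X. \<forall>i\<le>m. \<exists>U\<in>\<V> i. V \<subseteq> U}" for m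
  define A where "A m = {f \<in> topspace (Cp X). \<exists>V\<in>W m. \<forall>x\<in>topspace X - V. f x = 1}" for m
  have Wdec: "W n \<subseteq> W m" if "m \<le> n" for m n
    unfolding W_def using that order_trans by blast
  obtain G where G: "\<And>m. finite (G m)" "\<And>m. G m \<subseteq> A m"
    "\<And>J. infinite J \<Longrightarrow> (\<Union>m\<in>J. G m) \<in> Omega_pt (Cp X) (Cp_zero X)"
  proof (rule S_fin_gp_decreasing[OF S, of A])
    show "A m \<in> Omega_pt (Cp X) (Cp_zero X)" for m
      unfolding A_def W_def
      by (intro functions_one_off_omega_cover X ne common_refinement_omega_cover) (use \<V> in blast)
    show "A n \<subseteq> A m" if "m \<le> n" for m n
      using Wdec[OF that] unfolding A_def by blast
  qed blast
  have ex: "\<exists>U. U \<in> \<V> m \<and> (\<forall>x\<in>topspace X - U. f x = 1)" if "f \<in> G m" for m f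
  proof -
    have "f \<in> A m" using G(2) that by blast
    then obtain V where V: "V \<in> W m" "\<forall>x\<in>topspace X - V. f x = 1" unfolding A_def by blast
    then obtain U where "U \<in> \<V> m" "V \<subseteq> U" unfolding W_def by blast
    with V(2) show ?thesis by blast
  qed
  define u where "u m f = (SOME U. U \<in> \<V> m \<and> (\<forall>x\<in>topspace X - U. f x = 1))" for m and f :: "'a \<Rightarrow> real"
  have u: "u m f \<in> \<V> m \<and> (\<forall>x\<in>topspace X - u m f. f x = 1)" if "f \<in> G m" for m f
    unfolding u_def by (rule someI_ex) (rule ex[OF that])
  have "\<exists>m. \<forall>k\<ge>m. \<exists>V\<in>u k ` G k. F \<subseteq> V" if F: "F \<in> fin_subsets (topspace X)" for F
  proof (rule cofinite_if_every_infinite_set_meets)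
    fix J :: "nat set" assume "infinite J"
    from G(3)[OF this] have "Cp_zero X \<in> Cp X closure_of (\<Union>m\<in>J. G m)" "(\<Union>m\<in>J. G m) \<subseteq> topspace (Cp X)"
      by (auto simp: Omega_pt_def)
    then have "\<forall>F\<in>fin_subsets (topspace X). \<forall>e>0. \<exists>f\<in>(\<Union>m\<in>J. G m). \<forall>x\<in>F. \<bar>f x - Cp_zero X x\<bar> < e"
      using closure_of_Cp_iff[OF Cp_zero_in_Cp _ ne] by simp
    from bspec[OF this F, rule_format, OF zero_less_one]
    obtain f where f: "f \<in> (\<Union>m\<in>J. G m)" "\<forall>x\<in>F. \<bar>f x - Cp_zero X x\<bar> < 1" by (rule bexE)
    then obtain n where n: "n \<in> J" "f \<in> G n" by blast
    have "F \<subseteq> u n f"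
    proof
      fix x assume "x \<in> F"
      then have "x \<in> topspace X" "\<bar>f x\<bar> < 1"
        using F f(2) by (auto simp: fin_subsets_def Cp_zero_def subset_iff)
      moreover have "f x = 1" if "x \<in> topspace X - u n f" using u[OF n(2)] that by blast
      ultimately show "x \<in> u n f" by force
    qed
    with n show "\<exists>n\<in>J. \<exists>V\<in>u n ` G n. F \<subseteq> V" by blast
  qed
  moreover have "finite (u m ` G m) \<and> u m ` G m \<subseteq> \<V> m" for m using G(1) u by blast
  ultimately show "\<exists>H. (\<forall>m. finite (H m) \<and> H m \<subseteq> \<V> m) \<and>
          (\<forall>F\<in>fin_subsets (topspace X). \<exists>m. \<forall>k\<ge>m. \<exists>V\<in>H k. F \<subseteq> V)"
    by (intro exI[of _ "\<lambda>m. u m ` G m"]) blast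
qed

section \<open>The equivalences\<close>

lemma S_fin_omega_if_Hurewicz_Pfin:
  assumes "Hurewicz_space (Pfin X)" "topspace X \<noteq> {}"
  shows "S_fin (omega_covers X) (gp (omega_covers X))"
  using One_has_no_winning_strategy_omega[OF assms] by (intro S_fin_if_One_has_no_winning_strategy) blast

theorem theorem45:
  fixes X :: "'a topology"
  assumes "completely_regular_space X" and "Hausdorff_space X"
    and "infinite (topspace X)"
  shows
    "(Hurewicz_space (Pfin X) \<longleftrightarrow>
        S_fin (omega_covers (Pfin X)) (gp (omega_covers (Pfin X)))) \<and>
     (Hurewicz_space (Pfin X) \<longleftrightarrow>
        S_fin (omega_covers X) (gp (omega_covers X))) \<and>
     (Hurewicz_space (Pfin X) \<longleftrightarrow>
        (\<forall>n\<ge>1. Hurewicz_space (finite_power X n))) \<and>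
     (Hurewicz_space (Pfin X) \<longleftrightarrow>
        (\<nexists>\<sigma>. G_fin_winning_One (omega_covers X) (gp (omega_covers X)) \<sigma>)) \<and>
     (Hurewicz_space (Pfin X) \<longleftrightarrow>
        S_fin (Omega_pt (Cp X) (Cp_zero X)) (gp (Omega_pt (Cp X) (Cp_zero X)))) \<and>
     (Hurewicz_space (Pfin X) \<longleftrightarrow>
        Reznichenko_space (Cp X) \<and> countable_fan_tightness (Cp X))"
proof -
  let ?P = "Hurewicz_space (Pfin X)"
  let ?S2 = "S_fin (omega_covers (Pfin X)) (gp (omega_covers (Pfin X)))"
  let ?S3 = "S_fin (omega_covers X) (gp (omega_covers X))"
  let ?H4 = "\<forall>n\<ge>1. Hurewicz_space (finite_power X n)"
  let ?G5 = "\<nexists>\<sigma>. G_fin_winning_One (omega_covers X) (gp (omega_covers X)) \<sigma>"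
  let ?S6 = "S_fin (Omega_pt (Cp X) (Cp_zero X)) (gp (Omega_pt (Cp X) (Cp_zero X)))"
  let ?R7 = "Reznichenko_space (Cp X) \<and> countable_fan_tightness (Cp X)"
  have ne: "topspace X \<noteq> {}" using assms(3) by auto
  have t1: "t1_space X" by (rule Hausdorff_imp_t1_space[OF assms(2)])
  have t1P: "t1_space (Pfin X)" and infP: "infinite (topspace (Pfin X))" and neP: "topspace (Pfin X) \<noteq> {}"
    using t1_space_Pfin[OF t1] infinite_Pfin[OF assms(3)] topspace_Pfin_nonempty[OF ne] .
  have E4: ?H4 if "eventual_omega_selections X"
    using Hurewicz_power_if_eventual_omega_selections[OF that t1 assms(3)] by blast
  \<comment> \<open>Two cycles through \<open>?H4\<close> and \<open>?P\<close>, one by the game and one by the function space;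
    then \<open>?S2\<close> is the condition \<open>?S3\<close> for the space of finite sets in place of \<open>X\<close>.\<close>
  have "?H4 \<Longrightarrow> ?P" by (rule Hurewicz_Pfin_if_powers[OF _ ne])
  moreover have "?P \<Longrightarrow> ?G5" using One_has_no_winning_strategy_omega[OF _ ne] by blast
  moreover have "?G5 \<Longrightarrow> ?S3" by (rule S_fin_if_One_has_no_winning_strategy)
  moreover have "?S3 \<Longrightarrow> ?H4" by (rule E4[OF eventual_omega_selections_if_S_fin])
  moreover have "?P \<Longrightarrow> ?R7"
  proof
    assume P: ?P
    show "Reznichenko_space (Cp X)"
      using S_fin_Omega_pt_Cp[OF P ne] by (rule Reznichenko_space_if_S_fin[OF t1_space_Cp])
    show "countable_fan_tightness (Cp X)"
      unfolding countable_fan_tightness_def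
      by (intro ballI, rule S_fin_mono[OF S_fin_Omega_pt_Cp[OF P ne]]) (auto simp: gp_def)
  qed
  moreover have "?R7 \<Longrightarrow> ?S6"
    by (intro S_fin_if_Reznichenko_space t1_space_Cp Cp_zero_in_Cp) simp_all
  moreover have "?S6 \<Longrightarrow> ?H4"
    by (rule E4[OF eventual_omega_selections_if_S_fin_Cp[OF assms(1,2) ne]])
  moreover have "?H4 \<Longrightarrow> ?S2"
  proof -
    assume H4: ?H4
    have "\<forall>n\<ge>1. Hurewicz_space (finite_power (Pfin X) n)"
      using Hurewicz_powers_Pfin[OF H4 ne] by blast
    from Hurewicz_Pfin_if_powers[OF this neP] show ?S2
      by (rule S_fin_omega_if_Hurewicz_Pfin[OF _ neP])
  qed
  moreover have "?S2 \<Longrightarrow> ?P"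
  proof -
    assume ?S2
    then have "Hurewicz_space (finite_power (Pfin X) 1)"
      by (intro Hurewicz_power_if_eventual_omega_selections eventual_omega_selections_if_S_fin
          t1P infP order_refl)
    then show ?P by (rule Hurewicz_if_first_power[OF _ neP])
  qed
  ultimately show ?thesis by blast
qed

end
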